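(* Let $A\in\mathbb{H}^{m\times n}$ have rank $r$, let $M$ and $N$ be positive definite quaternion matrices of order $m$ and $n$, and let $A^{\dagger}_{M,N}=(\tilde a^{\dagger}_{ij})\in\mathbb{H}^{n\times m}$ be the weighted Moore-Penrose inverse of $A$. Let $n^{-1/2}_{ik}$ denote the $(i,k)$ entry of $N^{-1/2}$ and $m^{1/2}_{lj}$ the $(l,j)$ entry of $M^{1/2}$. (1) Suppose $A^{\sharp}A$ is non-Hermitian. If $r<n$, then for all $1\le i\le n$, $1\le j\le m$, $$\tilde a^{\dagger}_{ij}=\frac{\sum_{k=1}^{n} n^{-1/2}_{ik}\sum_{\beta\in J_{r,n}\{k\}}\mathrm{cdet}_k\left(\left(N^{-1/2}A^{*}MAN^{-1/2}\right)_{.k}\left(\left(N^{-1/2}A^{*}M\right)_{.j}\right)\right)^{\beta}_{\beta}}{\sum_{\beta\in J_{r,n}}\left|\left(N^{-1/2}A^{*}MAN^{-1/2}\right)^{\beta}_{\beta}\right|},$$ where $(N^{-1/2}A^{*}M)_{.j}$ is the $j$-th column of $N^{-1/2}A^{*}M$. If $r=n$, then $$\tilde a^{\dagger}_{ij}=\frac{\mathrm{cdet}_i\left(\left(A^{*}MA\right)_{.i}\left(\hat a_{.j}\right)\right)}{\det(A^{*}MA)},$$ where $\hat a_{.j}$ is the $j$-th column of $A^{*}M$. (2) Suppose $AA^{\sharp}$ is non-Hermitian. If $r<m$, then for all $1\le i\le n$, $1\le j\le m$, $$\tilde a^{\dagger}_{ij}=\frac{\sum_{l=1}^{m}\left(\sum_{\alpha\in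 I_{r,m}\{l\}}\mathrm{rdet}_l\left(\left(M^{1/2}AN^{-1}A^{*}M^{1/2}\right)_{l.}\left(\left(N^{-1}A^{*}M^{1/2}\right)_{i.}\right)\right)^{\alpha}_{\alpha}\right) m^{1/2}_{lj}}{\sum_{\alpha\in I_{r,m}}\left|\left(M^{1/2}AN^{-1}A^{*}M^{1/2}\right)^{\alpha}_{\alpha}\right|},$$ where $(N^{-1}A^{*}M^{1/2})_{i.}$ is the $i$-th row of $N^{-1}A^{*}M^{1/2}$. If $r=m$, then $$\tilde a^{\dagger}_{ij}=\frac{\mathrm{rdet}_j\left(\left(AN^{-1}A^{*}\right)_{j.}\left(\check a_{i.}\right)\right)}{\det(AN^{-1}A^{*})},$$ where $\check a_{i.}$ is the $i$-th row of $N^{-1}A^{*}$.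
   Context: $\mathbb{H}$ is the skew field of real quaternions; $A^{*}$ is the conjugate transpose; $B$ is Hermitian if $B^{*}=B$; $P$ is positive definite if it is Hermitian and $x^{*}Px>0$ for all nonzero columns $x$; $P^{1/2}$ is then its unique positive definite square root, and $N^{-1/2}=(N^{-1})^{1/2}$. $A^{\sharp}:=N^{-1}A^{*}M$. $A^{\dagger}_{M,N}$ is the unique $X\in\mathbb{H}^{n\times m}$ with $AXA=A$, $XAX=X$, $(MAX)^{*}=MAX$, $(NXA)^{*}=NXA$. Row and column determinants of $B=(b_{ij})\in\mathbb{H}^{n\times n}$. For fixed $i$, write each $\sigma\in S_n$ as a product of $r=r(\sigma)$ disjoint cycles (1-cycles included) $\sigma=(i\,i_{k_1}\,i_{k_1+1}\ldots i_{k_1+l_1})(i_{k_2}\,i_{k_2+1}\ldots i_{k_2+l_2})\cdots(i_{k_r}\,i_{k_r+1}\ldots i_{k_r+l_r})$, the first cycle starting with $i$, every other cycle starting with its smallest element, and $i_{k_2}<i_{k_3}<\dots<i_{k_r}$. Then $$\mathrm{rdet}_i B=\sum_{\sigma\in S_n}(-1)^{n-r}\,b_{i i_{k_1}}b_{i_{k_1}i_{k_1+1}}\cdots b_{i_{k_1+l_1}i}\cdots b_{i_{k_r}i_{k_r+1}}\cdots b_{i_{k_r+l_r}i_{k_r}}.$$ For fixed $j$, write each $\tau\in S_n$ as $\tau=(j_{k_r+l_r}\ldots j_{k_r+1}\,j_{k_r})\cdots(j_{k_2+l_2}\ldots j_{k_2+1}\,j_{k_2})(j_{k_1+l_1}\ldots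 j_{k_1+1}\,j_{k_1}\,j)$, the last (rightmost) cycle ending with $j$, every other cycle ending with its smallest element, and $j_{k_2}<j_{k_3}<\dots<j_{k_r}$. Then $$\mathrm{cdet}_j B=\sum_{\tau\in S_n}(-1)^{n-r}\,b_{j_{k_r}j_{k_r+l_r}}\cdots b_{j_{k_r+1}j_{k_r}}\cdots b_{j j_{k_1+l_1}}\cdots b_{j_{k_1+1}j_{k_1}}b_{j_{k_1}j}.$$ (A 1-cycle $(s)$ contributes the factor $b_{ss}$.) For Hermitian $B$ all $\mathrm{rdet}_iB$ and $\mathrm{cdet}_iB$ coincide and are real; the common value is $\det B$. $B_{.i}(c)$ (resp. $B_{i.}(c)$) is $B$ with its $i$-th column (resp. row) replaced by the column (resp. row) $c$. $B^{\alpha}_{\alpha}$ is the principal submatrix with rows and columns indexed by $\alpha$; its rows and columns keep their original indices, so that $\mathrm{cdet}_k(B)^{\beta}_{\beta}$ and $\mathrm{rdet}_l(B)^{\alpha}_{\alpha}$ are the column/row determinant of the submatrix along the column/row with original index $k\in\beta$, resp. $l\in\alpha$. For Hermitian $B$, $|B^{\alpha}_{\alpha}|=\det(B^{\alpha}_{\alpha})$. $L_{k,n}$ ($1\le k\le n$) is the set of strictly increasing sequences of $k$ integers from $\{1,\dots,n\}$; $I_{r,m}=L_{r,m}$, $J_{r,n}=L_{r,n}$, $I_{r,m}\{l\}=\{\alpha\in L_{r,m}: l\in\alpha\}$, $J_{r,n}\{k\}=\{\beta\in L_{r,n}: k\in\beta\}$; $r\ge1$ is understood. *)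

theory Defs
  imports "HOL-Analysis.Analysis" "HOL-Combinatorics.Combinatorics"
begin

section \<open>The skew field of real quaternions\<close>

codatatype quat = Quat (QRe: real) (QI: real) (QJ: real) (QK: real)

lemma quat_eq_iff:
  "x = y \<longleftrightarrow> QRe x = QRe y \<and> QI x = QI y \<and> QJ x = QJ y \<and> QK x = QK y"
  by (auto intro: quat.expand)

lemma quat_eqI:
  "\<lbrakk>QRe x = QRe y; QI x = QI y; QJ x = QJ y; QK x = QK y\<rbrakk> \<Longrightarrow> x = y"
  by (simp add: quat_eq_iff)

instantiation quat :: ab_group_add
begin

primcorec zero_quat where
  "QRe 0 = 0" | "QI 0 = 0" | "QJ 0 = 0" | "QK 0 = 0"

primcorec plus_quat where
  "QRe (x + y) = QRe x + QRe y"
| "QI (x + y) = QI x + QI y"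
| "QJ (x + y) = QJ x + QJ y"
| "QK (x + y) = QK x + QK y"

primcorec uminus_quat where
  "QRe (- x) = - QRe x"
| "QI (- x) = - QI x"
| "QJ (- x) = - QJ x"
| "QK (- x) = - QK x"

primcorec minus_quat where
  "QRe (x - y) = QRe x - QRe y"
| "QI (x - y) = QI x - QI y"
| "QJ (x - y) = QJ x - QJ y"
| "QK (x - y) = QK x - QK y"

instance
  by standard (simp_all add: quat_eq_iff)

end

instantiation quat :: ring_1
begin

primcorec one_quat where
  "QRe 1 = 1" | "QI 1 = 0" | "QJ 1 = 0" | "QK 1 = 0"

primcorec times_quat where
  "QRe (x * y) = QRe x * QRe y - QI x * QI y - QJ x * QJ y - QK x * QK y"
| "QI (x * y) = QRe x * QI y + QI x * QRe y + QJ x * QK y - QK x * QJ y"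
| "QJ (x * y) = QRe x * QJ y - QI x * QK y + QJ x * QRe y + QK x * QI y"
| "QK (x * y) = QRe x * QK y + QI x * QJ y - QJ x * QI y + QK x * QRe y"

instance
  by standard (simp_all add: quat_eq_iff algebra_simps)

end

definition qnorm2 :: "quat \<Rightarrow> real" where
  "qnorm2 x = (QRe x)\<^sup>2 + (QI x)\<^sup>2 + (QJ x)\<^sup>2 + (QK x)\<^sup>2"

lemma qnorm2_eq_0_iff [simp]: "qnorm2 x = 0 \<longleftrightarrow> x = 0"
  by (simp add: qnorm2_def quat_eq_iff add_nonneg_eq_0_iff)

primcorec qcnj :: "quat \<Rightarrow> quat" where
  "QRe (qcnj x) = QRe x"
| "QI (qcnj x) = - QI x"
| "QJ (qcnj x) = - QJ x"
| "QK (qcnj x) = - QK x"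

instantiation quat :: real_algebra_1
begin

primcorec scaleR_quat where
  "QRe (scaleR r x) = r * QRe x"
| "QI (scaleR r x) = r * QI x"
| "QJ (scaleR r x) = r * QJ x"
| "QK (scaleR r x) = r * QK x"

instance
  by standard (simp_all add: quat_eq_iff algebra_simps)

end

lemma qcnj_mult_self: "qcnj x * x = qnorm2 x *\<^sub>R 1"
  and mult_qcnj_self: "x * qcnj x = qnorm2 x *\<^sub>R 1"
  by (simp_all add: quat_eq_iff qnorm2_def power2_eq_square)

instantiation quat :: real_div_algebra
begin

definition inverse_quat :: "quat \<Rightarrow> quat" where
  "inverse x = qcnj x /\<^sub>R qnorm2 x"

definition "x div y = x * inverse y" for x y :: quat

instance
proof
  fix x y :: quat
  show "x \<noteq> 0 \<Longrightarrow> inverse x * x = 1" "x \<noteq> 0 \<Longrightarrow> x * inverse x = 1"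
    by (simp_all add: inverse_quat_def qcnj_mult_self mult_qcnj_self)
  show "x div y = x * inverse y"
    by (simp add: divide_quat_def)
  show "inverse (0::quat) = 0"
    by (simp add: inverse_quat_def quat_eq_iff)
qed

end


section \<open>Quaternion matrices\<close>

text \<open>An \<open>m \<times> n\<close> matrix has type \<^typ>\<open>quat^'n^'m\<close>. The index types are finite linear
  orders, so they are copies of \<open>{1..m}\<close> and \<open>{1..n}\<close>; the order enters only through the
  arrangement of cycles in the row and column determinants.\<close>

definition adj :: "quat^'n^'m \<Rightarrow> quat^'m^'n" where
  "adj A = (\<chi> i j. qcnj (A $ j $ i))"

definition hermitian :: "quat^'n^'n \<Rightarrow> bool" where
  "hermitian B \<longleftrightarrow> adj B = B"

definition pos_def :: "quat^'n^'n \<Rightarrow> bool" where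
  "pos_def P \<longleftrightarrow> hermitian P \<and>
     (\<forall>x. x \<noteq> 0 \<longrightarrow> (\<exists>c::real. c > 0 \<and>
        (\<Sum>i\<in>UNIV. qcnj (x $ i) * (P *v x) $ i) = of_real c))"

definition mat_sqrt :: "quat^'n^'n \<Rightarrow> quat^'n^'n" where
  "mat_sqrt P = (THE Q. pos_def Q \<and> Q ** Q = P)"

text \<open>The rank is the maximal number of right linearly independent columns, which is the
  dimension of the right column space.\<close>

definition right_indep_cols :: "quat^'n^'m \<Rightarrow> 'n set \<Rightarrow> bool" where
  "right_indep_cols A S \<longleftrightarrow>
     (\<forall>c. (\<forall>i. (\<Sum>j\<in>S. A $ i $ j * c j) = 0) \<longrightarrow> (\<forall>j\<in>S. c j = 0))"

definition qrank :: "quat^'n^'m \<Rightarrow> nat" where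
  "qrank A = Max {card S | S. right_indep_cols A S}"

definition wadj :: "quat^'m^'m \<Rightarrow> quat^'n^'n \<Rightarrow> quat^'n^'m \<Rightarrow> quat^'m^'n" where
  "wadj M N A = matrix_inv N ** adj A ** M"

definition wmp_inverse :: "quat^'m^'m \<Rightarrow> quat^'n^'n \<Rightarrow> quat^'n^'m \<Rightarrow> quat^'m^'n" where
  "wmp_inverse M N A = (THE X. A ** X ** A = A \<and> X ** A ** X = X \<and>
     adj (M ** A ** X) = M ** A ** X \<and> adj (N ** X ** A) = N ** X ** A)"

definition repl_col :: "'n \<Rightarrow> quat^'m \<Rightarrow> quat^'n^'m \<Rightarrow> quat^'n^'m" where
  "repl_col k c B = (\<chi> i j. if j = k then c $ i else B $ i $ j)"

definition repl_row :: "'m \<Rightarrow> quat^'n \<Rightarrow> quat^'n^'m \<Rightarrow> quat^'n^'m" where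
  "repl_row k c B = (\<chi> i j. if i = k then c $ j else B $ i $ j)"


section \<open>Row and column determinants\<close>

text \<open>All determinants below take a set \<open>S\<close> of indices and refer to the principal submatrix
  of \<open>B\<close> with rows and columns in \<open>S\<close>, keeping the original indices; the determinant of
  \<open>B\<close> itself is the case \<open>S = UNIV\<close>.

  \<^term>\<open>support \<sigma> s\<close> is the list \<open>[s, \<sigma> s, \<sigma> (\<sigma> s), \<dots>]\<close> running once through the
  cycle of \<open>s\<close>, so \<open>cycle_factors B \<sigma> s\<close> is
  \<open>[b s (\<sigma> s), b (\<sigma> s) (\<sigma> (\<sigma> s)), \<dots>, b (\<dots>) s]\<close>. Both kinds of determinant use this list
  for each cycle: a cycle written with \<open>s\<close> at its end in the column determinant also
  contributes a product whose first row index and last column index are \<open>s\<close>. They differ in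
  the order in which the cycles are arranged.\<close>

definition cycle_factors :: "quat^'n^'n \<Rightarrow> ('n \<Rightarrow> 'n) \<Rightarrow> 'n \<Rightarrow> quat list" where
  "cycle_factors B \<sigma> s = map (\<lambda>x. B $ x $ \<sigma> x) (support \<sigma> s)"

definition cycle_sets :: "'n set \<Rightarrow> ('n \<Rightarrow> 'n) \<Rightarrow> 'n set set" where
  "cycle_sets S \<sigma> = (\<lambda>s. set (support \<sigma> s)) ` S"

text \<open>The increasing list of the smallest elements of the cycles not containing \<open>i\<close>.\<close>

definition other_starts :: "'n::{finite,linorder} set \<Rightarrow> 'n \<Rightarrow> ('n \<Rightarrow> 'n) \<Rightarrow> 'n list" where
  "other_starts S i \<sigma> = sorted_list_of_set (Min ` {C \<in> cycle_sets S \<sigma>. i \<notin> C})"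

definition rdet :: "'n::{finite,linorder} set \<Rightarrow> 'n \<Rightarrow> quat^'n::{finite,linorder}^'n::{finite,linorder} \<Rightarrow> quat" where
  "rdet S i B = (\<Sum>\<sigma> | \<sigma> permutes S. (-1) ^ (card S - card (cycle_sets S \<sigma>)) *
     prod_list (concat (map (cycle_factors B \<sigma>) (i # other_starts S i \<sigma>))))"

definition cdet :: "'n::{finite,linorder} set \<Rightarrow> 'n \<Rightarrow> quat^'n::{finite,linorder}^'n::{finite,linorder} \<Rightarrow> quat" where
  "cdet S j B = (\<Sum>\<tau> | \<tau> permutes S. (-1) ^ (card S - card (cycle_sets S \<tau>)) *
     prod_list (concat (map (cycle_factors B \<tau>) (rev (other_starts S j \<tau>) @ [j]))))"

text \<open>The determinant of a Hermitian matrix: the common real value of all its row and column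
  determinants (meaningful for \<open>S \<noteq> {}\<close>).\<close>

definition hdet :: "'n::{finite,linorder} set \<Rightarrow> quat^'n::{finite,linorder}^'n::{finite,linorder} \<Rightarrow> real" where
  "hdet S B = (THE d. \<forall>i\<in>S. rdet S i B = of_real d \<and> cdet S i B = of_real d)"

text \<open>Strictly increasing sequences of \<open>k\<close> indices are represented by their sets of entries.\<close>

definition idx_sets :: "nat \<Rightarrow> 'n::finite set set" where
  "idx_sets k = {\<alpha>. card \<alpha> = k}"

definition idx_sets_with :: "nat \<Rightarrow> 'n::finite \<Rightarrow> 'n set set" where
  "idx_sets_with k l = {\<alpha> \<in> idx_sets k. l \<in> \<alpha>}"

end

theory Submission
  imports Defs
begin

text \<open>With \<open>C = M\<^sup>1\<^sup>/\<^sup>2 A N\<^sup>-\<^sup>1\<^sup>/\<^sup>2\<close> and \<open>B = C\<^sup>* C\<close>, the columns \<open>x\<close> of \<open>N\<^sup>1\<^sup>/\<^sup>2 A\<^sup>\<dagger>\<close> lie in the range of the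
  positive semidefinite matrix \<open>B\<close>, and the columns of \<open>B (N\<^sup>1\<^sup>/\<^sup>2 A\<^sup>\<dagger>)\<close> are those of
  \<open>N\<^sup>-\<^sup>1\<^sup>/\<^sup>2 A\<^sup>* M\<close>. So it suffices to recover \<open>x\<close> from \<open>B x\<close>.

  Splitting a permutation into its cycle through \<open>k\<close> and the rest writes the column
  determinant as a sum over paths from \<open>k\<close>. For Hermitian \<open>B\<close> this shows that all
  determinants agree and are real, and gives Cramer's rule. Let \<open>F\<^sub>s(v)\<close> be the sum over
  \<open>\<beta> \<in> J\<^sub>s{k}\<close> of the column determinants with column \<open>k\<close> replaced by \<open>v\<close>, and let \<open>d\<^sub>s\<close> be the sum of
  the principal minors of order \<open>s\<close>. Then \<open>F\<^sub>s(B x) + F\<^sub>s\<^sub>+\<^sub>1(x) = d\<^sub>s x\<^sub>k\<close> for every \<open>x\<close>. If \<open>r\<close> is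
  the rank of \<open>B\<close>, then \<open>d\<^sub>s = 0\<close> for \<open>s > r\<close>, so downward induction on \<open>s\<close> gives \<open>F\<^sub>s = 0\<close> on
  the range of \<open>B\<close> for \<open>s > r\<close>. Hence \<open>F\<^sub>r(B x) = d\<^sub>r x\<^sub>k\<close> there, and \<open>d\<^sub>r > 0\<close>.

  The row formulas follow by applying the column formulas to \<open>A\<^sup>*\<close> with the weights \<open>N\<^sup>-\<^sup>1\<close> and
  \<open>M\<^sup>-\<^sup>1\<close>.\<close>

section \<open>Paths and cycles of permutations\<close>

lemma permutation_of_permutes:
  fixes S :: "'a::finite set"
  shows "\<sigma> permutes S \<Longrightarrow> permutation \<sigma>"
  using permutation_permutes finite by blast

text \<open>Both the list and its length come from the iterates of \<open>s\<close>. By induction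
  these agree, since every iterate under \<open>p\<close> lies in the support, where
  \<open>f\<close> and \<open>p\<close> coincide.\<close>

lemma support_cong:
  assumes "permutation p" and "\<And>x. x \<in> set (support p s) \<Longrightarrow> f x = p x"
  shows "support f s = support p s"
proof -
  have *: "(f ^^ i) s = (p ^^ i) s" for i
  proof (induction i)
    case (Suc i)
    have "(p ^^ i) s \<in> set (support p s)"
      unfolding support_set[OF assms(1)] by blast
    with Suc assms(2) show ?case by simp
  qed simp
  then have "least_power f s = least_power p s"
    by (simp add: least_power_def)
  with * show ?thesis by simp
qed

text \<open>Applying the cycle \<open>n\<close> times rotates the list \<open>n\<close> times, so
  the \<open>n\<close>-th iterate of the head is \<open>p ! (n mod length p)\<close>. As
  \<open>p\<close> is distinct, it first returns after \<open>length p\<close> steps.\<close>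

lemma support_cycle_of_list:
  assumes "distinct p" "p \<noteq> []"
  shows "support (cycle_of_list p) (hd p) = p"
proof -
  let ?c = "cycle_of_list p"
  have iter: "(?c ^^ n) (hd p) = p ! (n mod length p)" for n
  proof -
    have "(?c ^^ n) (hd p) = hd (map (?c ^^ n) p)"
      using assms(2) by (simp add: hd_map)
    also have "\<dots> = p ! (n mod length p)"
      using assms by (simp add: cyclic_rotation hd_rotate_conv_nth)
    finally show ?thesis .
  qed
  have hd0: "hd p = p ! 0" using assms(2) by (rule hd_conv_nth)
  have "least_power ?c (hd p) = length p"
    unfolding least_power_def
  proof (rule Least_equality)
    show "(?c ^^ length p) (hd p) = hd p \<and> 0 < length p"
      using assms(2) iter[of "length p"] hd0 by simp
  next
    fix n assume n: "(?c ^^ n) (hd p) = hd p \<and> 0 < n"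
    then have "p ! (n mod length p) = p ! 0" using iter[of n] hd0 by simp
    then have "n mod length p = 0"
      using assms by (subst (asm) nth_eq_iff_index_eq) auto
    with n show "length p \<le> n" by (simp add: dvd_imp_le mod_eq_0_iff_dvd)
  qed
  then show ?thesis
    by (intro nth_equalityI) (simp_all add: iter)
qed

lemma support_ne: "permutation \<sigma> \<Longrightarrow> support \<sigma> x \<noteq> []"
  by (simp add: least_power_of_permutation(2))

lemma hd_support: "permutation \<sigma> \<Longrightarrow> hd (support \<sigma> x) = x"
  by (simp add: hd_map least_power_of_permutation(2))

lemma in_support: "permutation \<sigma> \<Longrightarrow> x \<in> set (support \<sigma> x)"
  by (metis support_ne hd_support hd_in_set)

lemma support_subset:
  assumes "\<sigma> permutes S" "x \<in> S"
  shows "set (support \<sigma> x) \<subseteq> S"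
  using assms by (auto simp: permutes_in_image[OF permutes_funpow[OF assms(1)]])

lemma cycle_sets_subset:
  fixes S :: "'n::finite set"
  assumes "\<sigma> permutes S" "C \<in> cycle_sets S \<sigma>"
  shows "C \<subseteq> S" "C \<noteq> {}"
proof -
  obtain x where x: "x \<in> S" "C = set (support \<sigma> x)"
    using assms(2) unfolding cycle_sets_def by (rule imageE)
  then show "C \<subseteq> S" using support_subset[OF assms(1)] by (simp only:)
  show "C \<noteq> {}"
    using x(2) in_support[OF permutation_of_permutes[OF assms(1)], of x] by (metis empty_iff)
qed

section \<open>Permutations as a cycle through \<open>k\<close> and a permutation of the
  rest\<close>

definition simple_paths :: "'n set \<Rightarrow> 'n \<Rightarrow> 'n list set" where
  "simple_paths S k = {p. p \<noteq> [] \<and> hd p = k \<and> distinct p \<and> set p \<subseteq> S}"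

lemma finite_simple_paths [simp]: "finite (simple_paths (S :: 'n::finite set) k)"
  by (rule finite_subset[OF _ finite_subset_distinct[OF finite[of S]]])
     (auto simp: simple_paths_def)

lemma simple_paths_Cons:
  "p \<in> simple_paths S k \<longleftrightarrow> (\<exists>q. p = k # q \<and> k \<in> S \<and> distinct q \<and> k \<notin> set q \<and> set q \<subseteq> S)"
  by (cases p) (auto simp: simple_paths_def)

lemma support_eq_cycle:
  assumes "permutation \<sigma>" "x \<in> set (support \<sigma> k)"
  shows "set (support \<sigma> x) = set (support \<sigma> k)"
proof -
  have "set (support \<sigma> x) \<inter> set (support \<sigma> k) \<noteq> {}"
    using assms in_support[OF assms(1), of x] by blast
  then show ?thesis
    using disjoint_support[OF assms(1)] by (meson UNIV_I disjoint_def image_iff)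
qed

text \<open>A cycle through \<open>k\<close> is encoded by the list that runs through it from
  \<open>k\<close>, so a simple path from \<open>k\<close> determines the cycle and conversely. The
  rest of \<open>\<sigma>\<close> is its restriction to the complement of this orbit.\<close>

lemma split_off_cycle:
  fixes S :: "'n::finite set"
  assumes "\<sigma> permutes S" "k \<in> S"
  defines "p \<equiv> support \<sigma> k"
  defines "\<tau> \<equiv> (\<lambda>y. if y \<in> S - set p then \<sigma> y else y)"
  shows "p \<in> simple_paths S k" "\<tau> permutes (S - set p)" "cycle_of_list p \<circ> \<tau> = \<sigma>"
proof -
  have perm: "permutation \<sigma>" using assms(1) by (rule permutation_of_permutes)
  show "p \<in> simple_paths S k"
    using support_ne[OF perm] hd_support[OF perm] cycle_of_permutation[OF perm]
      support_subset[OF assms(1,2)] unfolding p_def simple_paths_def by blast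
  show "\<tau> permutes (S - set p)"
    unfolding \<tau>_def p_def using semidecomposition[OF assms(1)] by simp
  show "cycle_of_list p \<circ> \<tau> = \<sigma>"
  proof
    fix a
    consider "a \<in> S - set p" | "a \<in> set p" | "a \<notin> S" "a \<notin> set p" by blast
    then show "(cycle_of_list p \<circ> \<tau>) a = \<sigma> a"
    proof cases
      case 1
      \<comment> \<open>The image of \<open>a\<close> stays in the orbit of \<open>a\<close>, which
        is disjoint from \<open>p\<close>, so the cycle fixes it.\<close>
      have "\<sigma> a \<in> set (support \<sigma> a)"
        unfolding support_set[OF perm] by (metis funpow_0 funpow_simps_right(2) o_apply rangeI)
      then have "\<sigma> a \<notin> set p"
        using 1 support_eq_cycle[OF perm] in_support[OF perm] unfolding p_def by blast
      with 1 show ?thesis by (simp add: \<tau>_def id_outside_supp)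
    next
      case 2
      then show ?thesis
        using cycle_restrict[OF perm] by (simp add: \<tau>_def p_def)
    next
      case 3
      then show ?thesis
        using assms(1) by (simp add: \<tau>_def id_outside_supp permutes_not_in)
    qed
  qed
qed

context
  fixes S :: "'n::finite set" and k p \<tau> \<sigma>
  assumes p: "p \<in> simple_paths S k" and \<tau>: "\<tau> permutes (S - set p)"
    and \<sigma>: "\<sigma> = cycle_of_list p \<circ> \<tau>"
begin

lemma add_cycle_eq:
  shows "x \<in> set p \<Longrightarrow> \<sigma> x = cycle_of_list p x" "x \<in> S - set p \<Longrightarrow> \<sigma> x = \<tau> x"
  using \<tau> permutes_in_image[OF \<tau>] permutes_not_in[OF \<tau>]
  by (auto simp: \<sigma> intro!: id_outside_supp)

lemma add_cycle_permutes: "\<sigma> permutes S"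
  unfolding \<sigma>
proof (rule permutes_compose)
  show "\<tau> permutes S" using \<tau> by (rule permutes_subset) auto
  show "cycle_of_list p permutes S"
    by (rule permutes_subset[OF cycle_permutes]) (use p in \<open>auto simp: simple_paths_def\<close>)
qed

text \<open>On \<open>set p\<close> the composite acts as the cycle and on the complement as
  \<open>\<tau>\<close>. Both sets are invariant, so \<open>support_cong\<close> applies on each of
  them.\<close>

lemma add_cycle_support:
  shows "support \<sigma> k = p" "x \<in> S - set p \<Longrightarrow> support \<sigma> x = support \<tau> x"
proof -
  have p': "distinct p" "p \<noteq> []" "hd p = k" using p by (auto simp: simple_paths_def)
  have "support \<sigma> k = support (cycle_of_list p) k"
  proof (rule support_cong[OF permutation_of_cycle])
    show "\<sigma> x = cycle_of_list p x" if "x \<in> set (support (cycle_of_list p) k)" for x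
      using that support_cycle_of_list[of p] p' add_cycle_eq(1)[of x] by metis
  qed
  then show "support \<sigma> k = p" using support_cycle_of_list[of p] p' by simp
  show "support \<sigma> x = support \<tau> x" if "x \<in> S - set p"
  proof (rule support_cong[OF permutation_of_permutes[OF \<tau>]])
    show "\<sigma> y = \<tau> y" if "y \<in> set (support \<tau> x)" for y
      using that support_subset[OF \<tau> \<open>x \<in> S - set p\<close>] add_cycle_eq(2)[of y] by blast
  qed
qed

lemma add_cycle_cycle_sets:
  shows "cycle_sets S \<sigma> = insert (set p) (cycle_sets (S - set p) \<tau>)"
    and "C \<in> cycle_sets (S - set p) \<tau> \<Longrightarrow> C \<subseteq> S - set p \<and> C \<noteq> {}"
    and "{C \<in> cycle_sets S \<sigma>. k \<notin> C} = cycle_sets (S - set p) \<tau>"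
    and "set p \<notin> cycle_sets (S - set p) \<tau>"
proof -
  have perm: "permutation \<sigma>" "permutation \<tau>"
    using add_cycle_permutes \<tau> permutation_of_permutes by blast+
  have kp: "k \<in> set p" "set p \<subseteq> S" "p \<noteq> []" using p by (auto simp: simple_paths_def)
  have 1: "set (support \<sigma> x) = set p" if "x \<in> set p" for x
    using support_eq_cycle[OF perm(1), of x k] that add_cycle_support(1) by metis
  have 2: "set (support \<sigma> x) = set (support \<tau> x)" if "x \<in> S - set p" for x
    using add_cycle_support(2)[OF that] by metis
  have "S = set p \<union> (S - set p)" using kp by blast
  then have "cycle_sets S \<sigma> = (\<lambda>s. set (support \<sigma> s)) ` set p \<union> (\<lambda>s. set (support \<sigma> s)) ` (S - set p)"
    unfolding cycle_sets_def by (metis image_Un)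
  also have "(\<lambda>s. set (support \<sigma> s)) ` set p = {set p}"
  proof -
    have "(\<lambda>s. set (support \<sigma> s)) ` set p = (\<lambda>s. set p) ` set p"
      by (rule image_cong[OF refl 1])
    also have "\<dots> = {set p}" using kp(1) by blast
    finally show ?thesis .
  qed
  also have "(\<lambda>s. set (support \<sigma> s)) ` (S - set p) = cycle_sets (S - set p) \<tau>"
    unfolding cycle_sets_def using 2 by (intro image_cong) auto
  finally show *: "cycle_sets S \<sigma> = insert (set p) (cycle_sets (S - set p) \<tau>)" by simp
  show **: "C \<subseteq> S - set p \<and> C \<noteq> {}" if "C \<in> cycle_sets (S - set p) \<tau>" for C
    using cycle_sets_subset[OF \<tau> that] by simp
  show "{C \<in> cycle_sets S \<sigma>. k \<notin> C} = cycle_sets (S - set p) \<tau>"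
    unfolding * using ** kp by auto
  show "set p \<notin> cycle_sets (S - set p) \<tau>"
    using **[of "set p"] kp by auto
qed

end

text \<open>Splitting off the cycle of \<open>k\<close> and composing it back are mutually inverse,
  which gives a bijection between permutations of \<open>S\<close> and pairs of a path and a
  permutation of its complement.\<close>

lemma sum_permutes_split:
  fixes S :: "'n::finite set"
  assumes "k \<in> S"
  shows "(\<Sum>\<sigma> | \<sigma> permutes S. g \<sigma>) =
    (\<Sum>p\<in>simple_paths S k. \<Sum>\<tau> | \<tau> permutes (S - set p). g (cycle_of_list p \<circ> \<tau>))"
proof -
  have "(\<Sum>p\<in>simple_paths S k. \<Sum>\<tau> | \<tau> permutes (S - set p). g (cycle_of_list p \<circ> \<tau>)) =
    (\<Sum>(p, \<tau>)\<in>(SIGMA p:simple_paths S k. {\<tau>. \<tau> permutes (S - set p)}). g (cycle_of_list p \<circ> \<tau>))"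
    by (rule sum.Sigma) (auto simp: finite_permutations)
  also have "\<dots> = (\<Sum>\<sigma> | \<sigma> permutes S. g \<sigma>)"
  proof (rule sum.reindex_bij_witness[where
        j = "\<lambda>(p, \<tau>). cycle_of_list p \<circ> \<tau>" and
        i = "\<lambda>\<sigma>. (support \<sigma> k, \<lambda>y. if y \<in> S - set (support \<sigma> k) then \<sigma> y else y)"], goal_cases)
    case (1 a)
    then obtain p \<tau> where a: "a = (p, \<tau>)" "p \<in> simple_paths S k" "\<tau> permutes (S - set p)"
      by auto
    have s: "support (cycle_of_list p \<circ> \<tau>) k = p"
      using add_cycle_support(1)[OF a(2,3) refl] .
    have "(if y \<in> S - set p then (cycle_of_list p \<circ> \<tau>) y else y) = \<tau> y" for y
      using add_cycle_eq(2)[OF a(2,3) refl, of y] permutes_not_in[OF a(3), of y] by auto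
    with s show ?case by (simp only: a prod.case)
  next
    case (2 a)
    then show ?case using add_cycle_permutes by fastforce
  next
    case (3 \<sigma>)
    then show ?case using split_off_cycle(3)[of \<sigma> S k] assms by simp
  next
    case (4 \<sigma>)
    then show ?case using split_off_cycle(1,2)[of \<sigma> S k] assms by simp
  qed auto
  finally show ?thesis by simp
qed

section \<open>Path expansion of column determinants\<close>

fun walk :: "quat^'n^'n \<Rightarrow> 'n list \<Rightarrow> quat^'n \<Rightarrow> quat" where
  "walk B [] v = 1"
| "walk B [x] v = v $ x"
| "walk B (x # y # p) v = B $ x $ y * walk B (y # p) v"

definition cycle_starts :: "'n::{finite,linorder} set \<Rightarrow> ('n \<Rightarrow> 'n) \<Rightarrow> 'n list" where
  "cycle_starts S \<sigma> = sorted_list_of_set (Min ` cycle_sets S \<sigma>)"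

text \<open>This is the cofactor left when the cycle through the distinguished column is removed:
  the remaining cycles keep their order, but none of them is distinguished any more. The empty set
  gives 1, the cofactor of a path through all of \<open>S\<close>.\<close>

definition pdet :: "'n::{finite,linorder} set \<Rightarrow> quat^'n::{finite,linorder}^'n::{finite,linorder} \<Rightarrow> quat" where
  "pdet S B = (\<Sum>\<sigma> | \<sigma> permutes S. (-1) ^ (card S - card (cycle_sets S \<sigma>)) *
     prod_list (concat (map (cycle_factors B \<sigma>) (rev (cycle_starts S \<sigma>)))))"

lemma pdet_empty [simp]: "pdet {} B = 1"
  by (simp add: pdet_def cycle_starts_def cycle_sets_def)

lemma cycle_factors_cong:
  assumes "\<sigma> permutes S" "s \<in> S" "\<And>x y. x \<in> S \<Longrightarrow> y \<in> S \<Longrightarrow> B $ x $ y = B' $ x $ y"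
  shows "cycle_factors B \<sigma> s = cycle_factors B' \<sigma> s"
  unfolding cycle_factors_def
proof (rule map_cong[OF refl])
  fix x assume "x \<in> set (support \<sigma> s)"
  then have "x \<in> S" using support_subset[OF assms(1,2)] by blast
  then show "B $ x $ \<sigma> x = B' $ x $ \<sigma> x"
    using assms(3) permutes_in_image[OF assms(1)] by blast
qed

lemma set_cycle_starts:
  assumes "\<sigma> permutes S"
  shows "set (cycle_starts S \<sigma>) \<subseteq> S"
proof -
  have "Min C \<in> S" if C: "C \<in> cycle_sets S \<sigma>" for C
  proof -
    have "C \<subseteq> S" "C \<noteq> {}" using cycle_sets_subset[OF assms C] by simp_all
    then show ?thesis using Min_in[of C] finite by blast
  qed
  then show ?thesis unfolding cycle_starts_def by auto
qed

lemma card_cycle_sets_le: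
  fixes S :: "'n::finite set"
  shows "card (cycle_sets S \<sigma>) \<le> card S"
  unfolding cycle_sets_def by (rule card_image_le) simp

lemma map_conv_map2: "map (\<lambda>x. g x (c x)) p = map2 g p (map c p)"
  by (induction p) auto

text \<open>Column \<open>k\<close> is read only in the last factor of the cycle, the one that
  returns to \<open>k\<close>; hence only this factor comes from \<open>v\<close>. For
  \<open>v = column k B\<close>, \<open>walk\<close> is the ordinary product around the
  cycle.\<close>

lemma walk_eq_cycle_factors:
  fixes p :: "'n::finite list"
  assumes "distinct (k # q)"
  shows "prod_list (map (\<lambda>x. repl_col k v B $ x $ cycle_of_list (k # q) x) (k # q)) = walk B (k # q) v"
proof -
  have *: "prod_list (map2 (\<lambda>x y. repl_col k v B $ x $ y) (x # q) (q @ [k])) = walk B (x # q) v"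
    if "k \<notin> set q" for x q
    using that by (induction q arbitrary: x) (auto simp: repl_col_def)
  have rot: "map (cycle_of_list (k # q)) (k # q) = q @ [k]"
    using cyclic_rotation[OF assms, of 1] by simp
  have "map (\<lambda>x. repl_col k v B $ x $ cycle_of_list (k # q) x) (k # q) =
      map2 (\<lambda>x y. repl_col k v B $ x $ y) (k # q) (map (cycle_of_list (k # q)) (k # q))"
    by (rule map_conv_map2)
  also have "\<dots> = map2 (\<lambda>x y. repl_col k v B $ x $ y) (k # q) (q @ [k])"
    unfolding rot ..
  finally show ?thesis using *[of q k] assms by simp
qed

text \<open>Sorting the permutations by the cycle through \<open>k\<close> expresses the column determinant
  by paths starting at \<open>k\<close>.\<close>

lemma cdet_repl_col:
  fixes S :: "'n::{finite,linorder} set"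
  assumes "k \<in> S"
  shows "cdet S k (repl_col k v B) =
    (\<Sum>p\<in>simple_paths S k. (-1) ^ (length p + 1) * pdet (S - set p) B * walk B p v)"
proof -
  let ?B = "repl_col k v B"
  have summand: "(-1) ^ (card S - card (cycle_sets S \<sigma>)) *
     prod_list (concat (map (cycle_factors ?B \<sigma>) (rev (other_starts S k \<sigma>) @ [k]))) =
     (-1) ^ (length p + 1) * ((-1) ^ (card T - card (cycle_sets T \<tau>)) *
     prod_list (concat (map (cycle_factors B \<tau>) (rev (cycle_starts T \<tau>))))) * walk B p v"
    if p: "p \<in> simple_paths S k" and \<tau>: "\<tau> permutes T" and T: "T = S - set p"
      and \<sigma>: "\<sigma> = cycle_of_list p \<circ> \<tau>"
    for p \<tau> \<sigma> T
  proof -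
    note \<tau>' = \<tau>[unfolded T]
    note ac = add_cycle_eq[OF p \<tau>' \<sigma>] add_cycle_support[OF p \<tau>' \<sigma>] add_cycle_cycle_sets[OF p \<tau>' \<sigma>]
    have kp: "k \<in> set p" "set p \<subseteq> S" "p \<noteq> []" "distinct p" "hd p = k"
      using p by (auto simp: simple_paths_def)
    have starts: "other_starts S k \<sigma> = cycle_starts T \<tau>"
      unfolding other_starts_def cycle_starts_def T ac(7) ..
    have "card (cycle_sets S \<sigma>) = Suc (card (cycle_sets T \<tau>))"
      unfolding ac(5) T using ac(8) by (simp add: cycle_sets_def)
    moreover have "card S = card T + length p"
    proof -
      have "card (set p) = length p" using kp(4) by (rule distinct_card)
      moreover have "card (set p) \<le> card S" using kp(2) by (intro card_mono) auto
      moreover have "card T = card S - card (set p)"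
        unfolding T using kp(2) by (intro card_Diff_subset) auto
      ultimately show ?thesis by linarith
    qed
    moreover have "card (cycle_sets T \<tau>) \<le> card T" by (rule card_cycle_sets_le)
    moreover have "length p \<ge> 1" using kp by (cases p) auto
    \<comment> \<open>Removing the cycle lowers the number of indices by \<open>length p\<close> and
      the number of cycles by 1, which changes the exponent by \<open>length p - 1\<close>. Adding 2
      keeps its parity and avoids subtraction on natural numbers.\<close>
    ultimately have "card S - card (cycle_sets S \<sigma>) + 2 = (length p + 1) + (card T - card (cycle_sets T \<tau>))"
      by simp
    then have "(-1::quat) ^ (card S - card (cycle_sets S \<sigma>) + 2) =
        (-1) ^ (length p + 1) * (-1) ^ (card T - card (cycle_sets T \<tau>))"
      by (metis power_add)
    then have sign: "(-1::quat) ^ (card S - card (cycle_sets S \<sigma>)) =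
        (-1) ^ (length p + 1) * (-1) ^ (card T - card (cycle_sets T \<tau>))"
      by (simp add: power_add)
    \<comment> \<open>The other cycles stay inside \<open>T\<close>, which does not contain
      \<open>k\<close>, so they never read the replaced column.\<close>
    have "map (cycle_factors ?B \<sigma>) (rev (cycle_starts T \<tau>)) = map (cycle_factors B \<tau>) (rev (cycle_starts T \<tau>))"
    proof (rule map_cong[OF refl])
      fix s assume "s \<in> set (rev (cycle_starts T \<tau>))"
      then have s: "s \<in> T" using set_cycle_starts[OF \<tau>] by auto
      have "cycle_factors ?B \<sigma> s = cycle_factors ?B \<tau> s"
        unfolding cycle_factors_def ac(4)[OF s[unfolded T]]
      proof (rule map_cong[OF refl])
        fix x assume "x \<in> set (support \<tau> s)"
        then have "x \<in> S - set p" using support_subset[OF \<tau> s] T by blast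
        then show "?B $ x $ \<sigma> x = ?B $ x $ \<tau> x" using ac(2) by simp
      qed
      also have "\<dots> = cycle_factors B \<tau> s"
        by (rule cycle_factors_cong[OF \<tau> s]) (use kp T in \<open>auto simp: repl_col_def\<close>)
      finally show "cycle_factors ?B \<sigma> s = cycle_factors B \<tau> s" .
    qed
    moreover have "prod_list (cycle_factors ?B \<sigma> k) = walk B p v"
    proof -
      have "prod_list (cycle_factors ?B \<sigma> k) = prod_list (map (\<lambda>x. ?B $ x $ cycle_of_list p x) p)"
        unfolding cycle_factors_def ac(3) by (simp only: ac(1) cong: map_cong)
      also obtain q where q: "p = k # q" using kp by (cases p) auto
      have "prod_list (map (\<lambda>x. ?B $ x $ cycle_of_list p x) p) = walk B p v"
        using walk_eq_cycle_factors[of k q v B] kp unfolding q by simp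
      finally show ?thesis .
    qed
    ultimately show ?thesis
      unfolding starts sign
      by (simp only: map_append concat_append prod_list.append list.map concat.simps append_Nil2 mult.assoc)
  qed
  have "cdet S k ?B = (\<Sum>p\<in>simple_paths S k. \<Sum>\<tau> | \<tau> permutes (S - set p).
     (-1) ^ (length p + 1) * ((-1) ^ (card (S - set p) - card (cycle_sets (S - set p) \<tau>)) *
     prod_list (concat (map (cycle_factors B \<tau>) (rev (cycle_starts (S - set p) \<tau>))))) * walk B p v)"
    unfolding cdet_def sum_permutes_split[OF assms]
    by (intro sum.cong refl summand) auto
  also have "\<dots> = (\<Sum>p\<in>simple_paths S k. (-1) ^ (length p + 1) * pdet (S - set p) B * walk B p v)"
    unfolding pdet_def by (simp only: sum_distrib_left sum_distrib_right)
  finally show ?thesis .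
qed

lemma repl_col_self [simp]: "repl_col k (column k B) B = B"
  by (simp add: repl_col_def column_def vec_eq_iff)

lemma cdet_conv_paths:
  assumes "k \<in> S"
  shows "cdet S k B =
    (\<Sum>p\<in>simple_paths S k. (-1) ^ (length p + 1) * pdet (S - set p) B * walk B p (column k B))"
  using cdet_repl_col[OF assms, of "column k B" B] by simp

text \<open>The cycle through \<open>Min S\<close> has the smallest minimum of all cycles. It
  therefore heads the increasing list of starts and stands last in the reversed product, exactly
  where the column determinant puts it.\<close>

lemma pdet_eq_cdet_Min:
  assumes "S \<noteq> {}"
  shows "pdet S B = cdet S (Min S) B"
  unfolding pdet_def cdet_def
proof (intro sum.cong refl)
  fix \<sigma> assume "\<sigma> \<in> {\<sigma>. \<sigma> permutes S}"
  then have \<sigma>: "\<sigma> permutes S" by simp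
  have perm: "permutation \<sigma>" using \<sigma> by (rule permutation_of_permutes)
  let ?m = "Min S"
  let ?O = "{C \<in> cycle_sets S \<sigma>. ?m \<notin> C}"
  define C0 where "C0 = set (support \<sigma> ?m)"
  have m: "?m \<in> S" using assms by simp
  have fin: "finite (cycle_sets S \<sigma>)" by (simp add: cycle_sets_def)
  note sub = cycle_sets_subset[OF \<sigma>]
  have C0: "C0 \<in> cycle_sets S \<sigma>" "C0 \<subseteq> S" "?m \<in> C0"
  proof -
    show "C0 \<in> cycle_sets S \<sigma>" unfolding C0_def cycle_sets_def using m by (rule imageI)
    show "C0 \<subseteq> S" unfolding C0_def using support_subset[OF \<sigma> m] .
    show "?m \<in> C0" unfolding C0_def using in_support[OF perm] .
  qed
  have eqC: "C = C0" if C: "C \<in> cycle_sets S \<sigma>" "?m \<in> C" for C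
  proof -
    obtain s where "C = set (support \<sigma> s)" using C(1) unfolding cycle_sets_def by (rule imageE)
    then show ?thesis using support_eq_cycle[OF perm] C(2) unfolding C0_def by (simp only:)
  qed
  have cs: "cycle_sets S \<sigma> = insert C0 ?O" using eqC C0 by blast
  have "Min C0 = ?m"
    using C0 by (intro Min_eqI) auto
  then have "Min ` cycle_sets S \<sigma> = insert ?m (Min ` ?O)"
    using cs by (metis image_insert)
  moreover have "\<forall>x\<in>Min ` ?O. ?m < x"
  proof
    fix x assume "x \<in> Min ` ?O"
    then obtain C where C: "C \<in> cycle_sets S \<sigma>" "?m \<notin> C" "x = Min C" by blast
    then have "x \<in> C" "C \<subseteq> S" using sub[of C] Min_in[of C] finite by auto
    then show "?m < x" using C(2) Min_le[of S x] by (metis finite in_mono order_le_imp_less_or_eq)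
  qed
  moreover have "sorted_list_of_set (insert ?m O') = ?m # sorted_list_of_set O'"
    if "\<forall>x\<in>O'. ?m < x" for O' :: "'a set"
  proof -
    have "Min (insert ?m O') = ?m" using that by (intro Min_eqI) auto
    moreover have "insert ?m O' - {?m} = O'" using that by auto
    ultimately show ?thesis using sorted_list_of_set_nonempty[of "insert ?m O'"] by simp
  qed
  ultimately have "cycle_starts S \<sigma> = ?m # other_starts S ?m \<sigma>"
    unfolding cycle_starts_def other_starts_def by (simp only:)
  then show "(-1) ^ (card S - card (cycle_sets S \<sigma>)) *
      prod_list (concat (map (cycle_factors B \<sigma>) (rev (cycle_starts S \<sigma>)))) =
     (-1) ^ (card S - card (cycle_sets S \<sigma>)) *
      prod_list (concat (map (cycle_factors B \<sigma>) (rev (other_starts S ?m \<sigma>) @ [?m])))"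
    by (simp only: rev.simps)
qed

section \<open>Determinants of Hermitian matrices\<close>

lemma qcnj_simps [simp]:
  shows "qcnj (x + y) = qcnj x + qcnj y" "qcnj (x - y) = qcnj x - qcnj y" "qcnj (- x) = - qcnj x"
    and "qcnj (x * y) = qcnj y * qcnj x" "qcnj 0 = 0" "qcnj 1 = 1" "qcnj (qcnj x) = x"
    and "qcnj (r *\<^sub>R x) = r *\<^sub>R qcnj x"
  by (simp_all add: quat_eq_iff algebra_simps)

lemma qcnj_of_real [simp]: "qcnj (of_real r) = of_real r"
  by (simp add: of_real_def)

lemma qcnj_sum [simp]: "qcnj (sum f A) = (\<Sum>x\<in>A. qcnj (f x))"
  by (induction A rule: infinite_finite_induct) auto

lemma qcnj_power [simp]: "qcnj (x ^ n) = qcnj x ^ n"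
  by (induction n) (simp_all add: power_commutes)

lemma QRe_of_real [simp]: "QRe (of_real r) = r"
  by (simp add: of_real_def)

lemma qcnj_eq_self_iff: "qcnj x = x \<longleftrightarrow> x = of_real (QRe x)"
  by (auto simp: quat_eq_iff of_real_def)

lemma QRe_sum [simp]: "QRe (sum f A) = (\<Sum>x\<in>A. QRe (f x))"
  by (induction A rule: infinite_finite_induct) auto

lemma QRe_mult_commute: "QRe (x * y) = QRe (y * x)"
  by simp

lemma QRe_of_real_mult [simp]: "QRe (of_real r * x) = r * QRe x"
  by (simp add: of_real_def)

lemma of_real_quat_commute: "of_real r * x = x * (of_real r :: quat)"
  by (simp add: of_real_def)

lemma minus_one_power_of_real: "(-1) ^ n = (of_real ((-1) ^ n) :: quat)"
  by simp

lemma hermitian_nth: "hermitian B \<Longrightarrow> qcnj (B $ i $ j) = B $ j $ i"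
  unfolding hermitian_def adj_def by (metis vec_lambda_beta)

text \<open>The vector enters only as a right factor, which is what makes column determinants right
  linear in the replaced column.\<close>

lemma walk_last: "p \<noteq> [] \<Longrightarrow> walk B p v = walk B p (\<chi> i. 1) * v $ last p"
  by (induction B p v rule: walk.induct) (auto simp: mult.assoc)

lemma walk_append:
  "q \<noteq> [] \<Longrightarrow> t \<noteq> [] \<Longrightarrow> walk B (q @ t) v = walk B q (column (hd t) B) * walk B t v"
  by (induction q rule: induct_list012) (auto simp: mult.assoc column_def neq_Nil_conv)

text \<open>Conjugation reverses the product and, for Hermitian \<open>B\<close>, swaps the indices
  of each entry, so the path is traversed backwards.\<close>

lemma qcnj_walk:
  assumes "hermitian B"
  shows "qcnj (walk B (k # q) (column l B)) = walk B (l # rev q) (column k B)"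
proof (induction q arbitrary: k)
  case Nil
  then show ?case by (simp add: column_def hermitian_nth[OF assms])
next
  case (Cons x q)
  have "walk B (l # rev (x # q)) (column k B) = walk B (l # rev q) (column x B) * walk B [x] (column k B)"
    using walk_append[of "l # rev q" "[x]" B "column k B"] by simp
  with Cons show ?case by (simp add: column_def hermitian_nth[OF assms])
qed

section \<open>Cutting, reversing and exchanging paths\<close>

lemma simple_paths_iff:
  "p \<in> simple_paths S k \<longleftrightarrow> p \<noteq> [] \<and> hd p = k \<and> distinct p \<and> set p \<subseteq> S"
  by (simp add: simple_paths_def)

lemma hd_in_simple_path: "p \<in> simple_paths S k \<Longrightarrow> k \<in> set p"
  by (auto simp: simple_paths_iff)

text \<open>A path from \<open>k\<close> either avoids \<open>s\<close> or is cut just before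
  \<open>s\<close>, uniquely, into a path \<open>q\<close> from \<open>k\<close> and a disjoint path
  \<open>t\<close> from \<open>s\<close>.\<close>

lemma sum_simple_paths_split:
  fixes S :: "'n::finite set"
  assumes "k \<noteq> s" "s \<in> S"
  shows "(\<Sum>p\<in>simple_paths S k. f p) = (\<Sum>q\<in>simple_paths (S - {s}) k. f q)
    + (\<Sum>q\<in>simple_paths (S - {s}) k. \<Sum>t\<in>simple_paths (S - set q) s. f (q @ t))"
proof -
  let ?P = "{p \<in> simple_paths S k. s \<in> set p}"
  have eq: "simple_paths S k = simple_paths (S - {s}) k \<union> ?P"
    by (auto simp: simple_paths_iff)
  have "(\<Sum>p\<in>simple_paths S k. f p) = (\<Sum>q\<in>simple_paths (S - {s}) k. f q) + (\<Sum>p\<in>?P. f p)"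
  proof (subst eq, rule sum.union_disjoint)
    show "finite ?P" by (rule finite_subset[OF _ finite_simple_paths[of S k]]) auto
  qed (auto simp: simple_paths_iff)
  also have "(\<Sum>p\<in>?P. f p) =
      (\<Sum>(q, t)\<in>(SIGMA q:simple_paths (S - {s}) k. simple_paths (S - set q) s). f (q @ t))"
  proof (rule sum.reindex_bij_witness[where
        i = "\<lambda>(q, t). q @ t" and j = "\<lambda>p. (takeWhile (\<lambda>x. x \<noteq> s) p, dropWhile (\<lambda>x. x \<noteq> s) p)"], goal_cases)
    case (2 p)
    then have p: "p \<noteq> []" "hd p = k" "distinct p" "set p \<subseteq> S" "s \<in> set p"
      by (auto simp: simple_paths_iff)
    obtain q t where qt: "p = q @ s # t" "s \<notin> set q"
      using split_list_first[OF p(5)] by blast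
    have "q \<noteq> []" using qt p assms by auto
    have t: "takeWhile (\<lambda>x. x \<noteq> s) p = q" unfolding qt using qt(2) by (subst takeWhile_append2) auto
    have d: "dropWhile (\<lambda>x. x \<noteq> s) p = s # t" unfolding qt using qt(2) by (subst dropWhile_append2) auto
    show ?case unfolding t d using p qt \<open>q \<noteq> []\<close> by (auto simp: simple_paths_iff)
  next
    case (3 a)
    then obtain q t where a: "a = (q, s # t)" "s \<notin> set q"
      by (fastforce simp: simple_paths_iff neq_Nil_conv)
    have "takeWhile (\<lambda>x. x \<noteq> s) (q @ s # t) = q" using a(2) by (subst takeWhile_append2) auto
    moreover have "dropWhile (\<lambda>x. x \<noteq> s) (q @ s # t) = s # t" using a(2) by (subst dropWhile_append2) auto
    ultimately show ?case by (simp add: a(1))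
  next
    case (4 a)
    then show ?case using assms by (fastforce simp: simple_paths_iff)
  qed auto
  also have "\<dots> = (\<Sum>q\<in>simple_paths (S - {s}) k. \<Sum>t\<in>simple_paths (S - set q) s. f (q @ t))"
    by (rule sum.Sigma[symmetric]) auto
  finally show ?thesis .
qed

text \<open>Both double sums range over all pairs of disjoint paths in \<open>S\<close>, one from
  \<open>k\<close> and one from \<open>s\<close>.\<close>

lemma sum_disjoint_paths_swap:
  fixes S :: "'n::finite set"
  assumes "k \<noteq> s"
  shows "(\<Sum>q\<in>simple_paths (S - {s}) k. \<Sum>t\<in>simple_paths (S - set q) s. g q t) =
    (\<Sum>t\<in>simple_paths (S - {k}) s. \<Sum>q\<in>simple_paths (S - set t) k. g q t)"
proof -
  let ?R = "\<lambda>q t. set q \<inter> set t = {}"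
  have "(\<Sum>q\<in>simple_paths (S - {s}) k. \<Sum>t\<in>simple_paths (S - set q) s. g q t) =
      (\<Sum>q\<in>simple_paths (S - {s}) k. \<Sum>t\<in>{t \<in> simple_paths (S - {k}) s. ?R q t}. g q t)"
    using hd_in_simple_path by (intro sum.cong refl) (fastforce simp: simple_paths_iff)+
  also have "\<dots> = (\<Sum>t\<in>simple_paths (S - {k}) s. \<Sum>q\<in>{q \<in> simple_paths (S - {s}) k. ?R q t}. g q t)"
    by (rule sum.swap_restrict) auto
  also have "\<dots> = (\<Sum>t\<in>simple_paths (S - {k}) s. \<Sum>q\<in>simple_paths (S - set t) k. g q t)"
    using hd_in_simple_path by (intro sum.cong refl) (fastforce simp: simple_paths_iff)+
  finally show ?thesis .
qed

text \<open>Reversing the path through \<open>k\<close> shows that a column determinant is real; rotating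
  a path through \<open>k\<close> and \<open>j\<close>, or exchanging disjoint paths at \<open>k\<close> and \<open>j\<close>, shows that it does
  not depend on the column.\<close>

lemma hermitian_cdet:
  fixes B :: "quat^'n::{finite,linorder}^'n::{finite,linorder}"
  assumes "hermitian B"
  shows "pdet S B = of_real (QRe (pdet S B))" "k \<in> S \<Longrightarrow> cdet S k B = pdet S B"
proof -
  have "pdet S B = of_real (QRe (pdet S B)) \<and> (\<forall>k\<in>S. cdet S k B = pdet S B)"
  proof (induction "card S" arbitrary: S rule: less_induct)
    case less
    show ?case
    proof (cases "S = {}")
      case False
      define d where "d T = QRe (pdet T B)" for T
      define W where "W p = walk B p (column (hd p) B)" for p
      have smaller: "card (S - set p) < card S" if "p \<in> simple_paths S k" for p k
        using that hd_in_simple_path[OF that] by (intro psubset_card_mono) (auto simp: simple_paths_iff)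
      \<comment> \<open>By induction the cofactors are real scalars, so conjugation and real parts
        act on \<open>W p\<close> alone.\<close>
      have d: "pdet (S - set p) B = of_real (d (S - set p))" if "p \<in> simple_paths S k" for p k
        using less[OF smaller[OF that]] unfolding d_def by blast
      have paths: "cdet S k B = (\<Sum>p\<in>simple_paths S k. of_real ((-1) ^ (length p + 1) * d (S - set p)) * W p)"
        if "k \<in> S" for k
        unfolding cdet_conv_paths[OF that]
      proof (intro sum.cong refl)
        fix p assume p: "p \<in> simple_paths S k"
        then have "hd p = k" by (simp add: simple_paths_iff)
        then show "(- 1) ^ (length p + 1) * pdet (S - set p) B * walk B p (column k B) =
            of_real ((-1) ^ (length p + 1) * d (S - set p)) * W p"
          unfolding d[OF p] W_def by simp
      qed
      have real: "cdet S k B = of_real (QRe (cdet S k B))" if k: "k \<in> S" for k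
      proof -
        have "qcnj (cdet S k B) =
            (\<Sum>p\<in>simple_paths S k. of_real ((-1) ^ (length p + 1) * d (S - set p)) * qcnj (W p))"
          unfolding paths[OF k] qcnj_sum qcnj_simps qcnj_of_real of_real_quat_commute ..
        \<comment> \<open>Reversing the tail is an involution on the paths from \<open>k\<close>
          that preserves length and vertex set, hence sign and cofactor.\<close>
        also have "\<dots> = (\<Sum>p\<in>simple_paths S k. of_real ((-1) ^ (length p + 1) * d (S - set p)) * W p)"
        proof (rule sum.reindex_bij_witness[where i = "\<lambda>p. k # rev (tl p)" and j = "\<lambda>p. k # rev (tl p)"])
          fix p assume "p \<in> simple_paths S k"
          then obtain q where q: "p = k # q" "k \<in> S" "distinct q" "k \<notin> set q" "set q \<subseteq> S"
            by (auto simp: simple_paths_Cons)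
          then show "k # rev (tl (k # rev (tl p))) = p" "k # rev (tl p) \<in> simple_paths S k"
            by (auto simp: simple_paths_Cons)
          show "k # rev (tl (k # rev (tl p))) = p" "k # rev (tl p) \<in> simple_paths S k"
            using q by (auto simp: simple_paths_Cons)
          show "of_real ((-1) ^ (length (k # rev (tl p)) + 1) * d (S - set (k # rev (tl p)))) * W (k # rev (tl p)) =
            of_real ((-1) ^ (length p + 1) * d (S - set p)) * qcnj (W p)"
            unfolding q W_def by (simp add: qcnj_walk[OF assms])
        qed
        also have "\<dots> = cdet S k B" unfolding paths[OF k] ..
        finally show ?thesis by (simp add: qcnj_eq_self_iff)
      qed
      have re: "QRe (cdet S k B) = (\<Sum>p\<in>simple_paths S k. (-1) ^ (length p + 1) * d (S - set p) * QRe (W p))"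
        if "k \<in> S" for k
        unfolding paths[OF that] QRe_sum QRe_of_real_mult ..
      \<comment> \<open>The cofactor of a path \<open>q\<close> that misses \<open>j\<close> is
        itself expanded along column \<open>j\<close>, which the induction hypothesis
        allows.\<close>
      have dexp: "d (S - set q) = (\<Sum>t\<in>simple_paths (S - set q) j. (-1) ^ (length t + 1) * d (S - set q - set t) * QRe (W t))"
        if q: "q \<in> simple_paths S k" "j \<in> S" "j \<notin> set q" for q j k
      proof -
        have j: "j \<in> S - set q" using q by blast
        have "d (S - set q) = QRe (cdet (S - set q) j B)"
          using less[OF smaller[OF q(1)]] j unfolding d_def by simp
        also have "\<dots> = (\<Sum>t\<in>simple_paths (S - set q) j. QRe ((-1) ^ (length t + 1) * pdet (S - set q - set t) B * walk B t (column j B)))"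
          unfolding cdet_conv_paths[OF j] QRe_sum ..
        also have "\<dots> = (\<Sum>t\<in>simple_paths (S - set q) j. (-1) ^ (length t + 1) * d (S - set q - set t) * QRe (W t))"
        proof (intro sum.cong refl)
          fix t assume t: "t \<in> simple_paths (S - set q) j"
          have "card (S - set q - set t) < card S"
            using smaller[OF q(1)] by (meson Diff_subset card_mono finite le_less_trans)
          then have "pdet (S - set q - set t) B = of_real (d (S - set q - set t))"
            using less unfolding d_def by blast
          moreover have "hd t = j" using t by (simp add: simple_paths_iff)
          ultimately show "QRe ((-1) ^ (length t + 1) * pdet (S - set q - set t) B * walk B t (column j B)) =
            (-1) ^ (length t + 1) * d (S - set q - set t) * QRe (W t)"
            unfolding W_def minus_one_power_of_real by (simp only: of_real_mult[symmetric] QRe_of_real_mult)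
        qed
        finally show ?thesis .
      qed
      \<comment> \<open>The first summand treats \<open>q\<close> and \<open>t\<close> as two
        separate cycles through \<open>k\<close> and \<open>j\<close>, the second as the single
        cycle \<open>q @ t\<close>. Both are symmetric in \<open>q\<close> and \<open>t\<close>, the
        second because real parts satisfy \<open>QRe (x * y) = QRe (y * x)\<close>.\<close>
      define F where "F q t = (-1) ^ (length q + 1) * (-1) ^ (length t + 1) * d (S - set q - set t) * QRe (W q) * QRe (W t)
          + (-1) ^ (length q + length t + 1) * d (S - set q - set t) * QRe (walk B q (column (hd t) B) * walk B t (column (hd q) B))"
        for q t
      have F_sym: "F q t = F t q" for q t
      proof -
        have "S - set q - set t = S - set t - set q" by blast
        then show ?thesis
          unfolding F_def
          by (simp only: mult_ac add_ac QRe_mult_commute[of "walk B q (column (hd t) B)"])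
      qed
      have gexp: "QRe (cdet S k B) = (\<Sum>q\<in>simple_paths (S - {j}) k. \<Sum>t\<in>simple_paths (S - set q) j. F q t)"
        if k: "k \<in> S" and j: "j \<in> S" and kj: "k \<noteq> j" for k j
      proof -
        have "(\<Sum>q\<in>simple_paths (S - {j}) k. (-1) ^ (length q + 1) * d (S - set q) * QRe (W q)) =
          (\<Sum>q\<in>simple_paths (S - {j}) k. \<Sum>t\<in>simple_paths (S - set q) j.
            (-1) ^ (length q + 1) * (-1) ^ (length t + 1) * d (S - set q - set t) * QRe (W q) * QRe (W t))"
        proof (intro sum.cong refl)
          fix q assume "q \<in> simple_paths (S - {j}) k"
          then have q: "q \<in> simple_paths S k" "j \<notin> set q" by (auto simp: simple_paths_iff)
          show "(-1) ^ (length q + 1) * d (S - set q) * QRe (W q) = (\<Sum>t\<in>simple_paths (S - set q) j.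
            (-1) ^ (length q + 1) * (-1) ^ (length t + 1) * d (S - set q - set t) * QRe (W q) * QRe (W t))"
            unfolding dexp[OF q(1) j q(2)] sum_distrib_left sum_distrib_right
            by (intro sum.cong refl) (simp only: mult_ac)
        qed
        moreover have "(\<Sum>q\<in>simple_paths (S - {j}) k. \<Sum>t\<in>simple_paths (S - set q) j.
            (-1) ^ (length (q @ t) + 1) * d (S - set (q @ t)) * QRe (W (q @ t))) =
          (\<Sum>q\<in>simple_paths (S - {j}) k. \<Sum>t\<in>simple_paths (S - set q) j.
            (-1) ^ (length q + length t + 1) * d (S - set q - set t) * QRe (walk B q (column (hd t) B) * walk B t (column (hd q) B)))"
        proof (intro sum.cong refl)
          fix q t assume "q \<in> simple_paths (S - {j}) k" "t \<in> simple_paths (S - set q) j"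
          then have "q \<noteq> []" "t \<noteq> []" by (auto simp: simple_paths_iff)
          moreover have "S - (set q \<union> set t) = S - set q - set t" by blast
          ultimately show "(-1) ^ (length (q @ t) + 1) * d (S - set (q @ t)) * QRe (W (q @ t)) =
            (-1) ^ (length q + length t + 1) * d (S - set q - set t) * QRe (walk B q (column (hd t) B) * walk B t (column (hd q) B))"
            unfolding W_def by (simp only: walk_append hd_append2 length_append set_append simp_thms)
        qed
        ultimately show ?thesis
          unfolding re[OF k] sum_simple_paths_split[OF kj j] F_def sum.distrib by simp
      qed
      have indep: "cdet S k B = cdet S j B" if k: "k \<in> S" and j: "j \<in> S" for k j
      proof (cases "k = j")
        case False
        have "QRe (cdet S k B) = (\<Sum>t\<in>simple_paths (S - {k}) j. \<Sum>q\<in>simple_paths (S - set t) k. F q t)"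
          unfolding gexp[OF k j False] by (rule sum_disjoint_paths_swap[OF False])
        also have "\<dots> = QRe (cdet S j B)"
          unfolding gexp[OF j k False[symmetric]] by (subst F_sym) (rule refl)
        finally show ?thesis using real[OF k] real[OF j] by metis
      qed simp
      have "Min S \<in> S" using False by simp
      then show ?thesis
        using real[of "Min S"] indep[of _ "Min S"] pdet_eq_cdet_Min[OF False, of B] by metis
    qed simp
  qed
  then show "pdet S B = of_real (QRe (pdet S B))" "k \<in> S \<Longrightarrow> cdet S k B = pdet S B"
    by blast+
qed

section \<open>Column replacement\<close>

lemma last_in_simple_path: "p \<in> simple_paths S k \<Longrightarrow> last p \<in> S"
  using last_in_set by (auto simp: simple_paths_iff)

lemma walk_axis:
  assumes "p \<in> simple_paths S k"
  shows "walk B p (axis s 1) = (if last p = s then walk B p (\<chi> i. 1) else 0)"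
  using assms walk_last[of p B "axis s 1"] by (simp add: simple_paths_iff axis_def)

text \<open>By \<open>walk_last\<close> every term of the path expansion ends in an entry of
  \<open>v\<close>, so coefficients on the right of the vectors can be pulled out on the
  right.\<close>

lemma cdet_repl_col_sum:
  fixes B :: "quat^'n::{finite,linorder}^'n::{finite,linorder}"
  assumes "k \<in> S" "v = (\<chi> i. \<Sum>s\<in>A. V s $ i * x s)"
  shows "cdet S k (repl_col k v B) = (\<Sum>s\<in>A. cdet S k (repl_col k (V s) B) * x s)"
proof -
  have "cdet S k (repl_col k v B) = (\<Sum>p\<in>simple_paths S k. \<Sum>s\<in>A.
      (-1) ^ (length p + 1) * pdet (S - set p) B * walk B p (V s) * x s)"
    unfolding cdet_repl_col[OF assms(1)]
  proof (intro sum.cong refl)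
    fix p assume "p \<in> simple_paths S k"
    then have ne: "p \<noteq> []" by (simp add: simple_paths_iff)
    show "(-1) ^ (length p + 1) * pdet (S - set p) B * walk B p v =
      (\<Sum>s\<in>A. (-1) ^ (length p + 1) * pdet (S - set p) B * walk B p (V s) * x s)"
    proof -
      have "walk B p (V s) = walk B p (\<chi> i. 1) * V s $ last p" for s
        using ne by (rule walk_last)
      moreover have "walk B p v = walk B p (\<chi> i. 1) * (\<Sum>s\<in>A. V s $ last p * x s)"
        using walk_last[OF ne, of B v] assms(2) by simp
      ultimately show ?thesis by (simp only: sum_distrib_left mult.assoc)
    qed
  qed
  also have "\<dots> = (\<Sum>s\<in>A. cdet S k (repl_col k (V s) B) * x s)"
    unfolding cdet_repl_col[OF assms(1)] sum_distrib_right by (rule sum.swap)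
  finally show ?thesis .
qed

lemma cdet_repl_col_mult_vec:
  "k \<in> S \<Longrightarrow> cdet S k (repl_col k (C *v x) B) = (\<Sum>s\<in>UNIV. cdet S k (repl_col k (column s C) B) * x $ s)"
  by (rule cdet_repl_col_sum) (simp_all add: matrix_vector_mult_def column_def)

lemma cdet_repl_col_axis_sum:
  "k \<in> S \<Longrightarrow> cdet S k (repl_col k x B) = (\<Sum>s\<in>UNIV. cdet S k (repl_col k (axis s 1) B) * x $ s)"
  by (rule cdet_repl_col_sum)
    (simp_all add: vec_eq_iff axis_def if_distrib[of "\<lambda>u. u * _"] cong: if_cong)

lemma cdet_repl_col_axis_notin:
  assumes "k \<in> S" "s \<notin> S"
  shows "cdet S k (repl_col k (axis s 1) B) = 0"
  unfolding cdet_repl_col[OF assms(1)]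
proof (rule sum.neutral, rule ballI)
  fix p assume p: "p \<in> simple_paths S k"
  then have "last p \<noteq> s" using assms(2) last_in_simple_path[OF p] by metis
  then show "(-1) ^ (length p + 1) * pdet (S - set p) B * walk B p (axis s 1) = 0"
    by (simp add: walk_axis[OF p])
qed

text \<open>A distinct list that ends where it begins has only one element.\<close>

lemma sum_simple_paths_last_eq_hd:
  fixes S :: "'n::finite set"
  assumes "k \<in> S" "\<And>p. p \<in> simple_paths S k \<Longrightarrow> last p \<noteq> k \<Longrightarrow> f p = 0"
  shows "(\<Sum>p\<in>simple_paths S k. f p) = f [k]"
proof -
  have "f p = 0" if p: "p \<in> simple_paths S k - {[k]}" for p
  proof -
    obtain q where "p = k # q" "q \<noteq> []" "k \<notin> set q"
      using p by (auto simp: simple_paths_Cons)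
    then have "last p \<noteq> k" by auto
    with p assms(2) show ?thesis by blast
  qed
  moreover have "[k] \<in> simple_paths S k" using assms(1) by (simp add: simple_paths_iff)
  ultimately show ?thesis
    by (subst sum.mono_neutral_right[of _ "{[k]}"]) auto
qed

lemma cdet_repl_col_axis_same:
  assumes "k \<in> S"
  shows "cdet S k (repl_col k (axis k 1) B) = pdet (S - {k}) B"
  unfolding cdet_repl_col[OF assms]
  by (subst sum_simple_paths_last_eq_hd[OF assms]) (simp_all add: walk_axis)

text \<open>Only paths \<open>q @ [s]\<close> survive. Their last step into \<open>s\<close> reads
  column \<open>s\<close> of \<open>B\<close>, so they match the paths \<open>q\<close> in
  \<open>S\<close> closed with that column; the extra vertex accounts for the sign.\<close>

lemma cdet_repl_col_axis_insert:
  assumes "k \<in> S" "s \<notin> S"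
  shows "cdet (insert s S) k (repl_col k (axis s 1) B) = - cdet S k (repl_col k (column s B) B)"
proof -
  let ?S = "insert s S"
  let ?f = "\<lambda>p. (-1) ^ (length p + 1) * pdet (?S - set p) B * walk B p (axis s 1)"
  have ks: "k \<noteq> s" "?S - {s} = S" using assms by auto
  have "cdet ?S k (repl_col k (axis s 1) B) = (\<Sum>q\<in>simple_paths S k. ?f q)
      + (\<Sum>q\<in>simple_paths S k. \<Sum>t\<in>simple_paths (?S - set q) s. ?f (q @ t))"
    using assms cdet_repl_col[of k ?S] sum_simple_paths_split[OF ks(1), of "?S" "?f"] by (simp add: ks(2))
  also have "(\<Sum>q\<in>simple_paths S k. ?f q) = 0"
  proof (rule sum.neutral, rule ballI)
    fix p assume p: "p \<in> simple_paths S k"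
    then have "last p \<noteq> s" using assms(2) last_in_simple_path[OF p] by metis
    then show "?f p = 0" by (simp add: walk_axis[OF p])
  qed
  also have "(\<Sum>q\<in>simple_paths S k. \<Sum>t\<in>simple_paths (?S - set q) s. ?f (q @ t)) =
      (\<Sum>q\<in>simple_paths S k. - ((-1) ^ (length q + 1) * pdet (S - set q) B * walk B q (column s B)))"
  proof (intro sum.cong refl)
    fix q assume q: "q \<in> simple_paths S k"
    then have q': "q \<noteq> []" "s \<notin> set q" using assms by (auto simp: simple_paths_iff)
    have "?f (q @ t) = 0" if t: "t \<in> simple_paths (?S - set q) s" and "last t \<noteq> s" for t
      using that q' walk_append[of q t B "axis s 1"] walk_axis[OF t, of B s] by (simp add: simple_paths_iff)
    then have "(\<Sum>t\<in>simple_paths (?S - set q) s. ?f (q @ t)) = ?f (q @ [s])"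
      using q' by (intro sum_simple_paths_last_eq_hd) auto
    also have "walk B (q @ [s]) (axis s 1) = walk B q (column s B)"
      using q' by (subst walk_append) (simp_all add: axis_def)
    also have "?S - set (q @ [s]) = S - set q" using assms by auto
    finally show "(\<Sum>t\<in>simple_paths (?S - set q) s. ?f (q @ t)) =
      - ((-1) ^ (length q + 1) * pdet (S - set q) B * walk B q (column s B))" by simp
  qed
  finally show ?thesis
    unfolding cdet_repl_col[OF assms(1)] by (simp add: sum_negf)
qed

text \<open>This is the vanishing of a determinant with two equal columns. For a path
  \<open>q\<close> avoiding \<open>s\<close>, the continuations \<open>q @ t\<close> through
  \<open>s\<close> add up to an expansion of \<open>cdet (S - set q) s B\<close>, which is the
  cofactor of \<open>q\<close>; the sign is opposite, so they cancel the term of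
  \<open>q\<close>.\<close>

lemma cdet_repl_col_other:
  fixes B :: "quat^'n::{finite,linorder}^'n::{finite,linorder}"
  assumes "hermitian B" "k \<in> S" "s \<in> S" "k \<noteq> s"
  shows "cdet S k (repl_col k (column s B) B) = 0"
proof -
  let ?f = "\<lambda>p. (-1) ^ (length p + 1) * pdet (S - set p) B * walk B p (column s B)"
  have "(\<Sum>t\<in>simple_paths (S - set q) s. ?f (q @ t)) = - ?f q"
    if q: "q \<in> simple_paths (S - {s}) k" for q
  proof -
    have q': "q \<noteq> []" "s \<in> S - set q" using assms q by (auto simp: simple_paths_iff)
    let ?c = "walk B q (column s B)"
    have "?f (q @ t) = (-1) ^ length q * ?c *
        ((-1) ^ (length t + 1) * pdet (S - set q - set t) B * walk B t (column s B))"
      if t: "t \<in> simple_paths (S - set q) s" for t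
    proof -
      have t': "t \<noteq> []" "hd t = s" using t by (auto simp: simple_paths_iff)
      define d where "d = QRe (pdet (S - set q - set t) B)"
      have "S - set (q @ t) = S - set q - set t" by auto
      moreover have "pdet (S - set q - set t) B = of_real d"
        unfolding d_def by (rule hermitian_cdet(1)[OF assms(1)])
      moreover have "?c * ((-1) ^ length t * y) = (-1) ^ length t * (?c * y)" for y
        by (simp add: minus_one_power_iff)
      ultimately show ?thesis
        using q' t' by (simp add: walk_append power_add mult.assoc of_real_quat_commute)
    qed
    then have "(\<Sum>t\<in>simple_paths (S - set q) s. ?f (q @ t)) =
        (-1) ^ length q * ?c * cdet (S - set q) s B"
      unfolding cdet_conv_paths[OF q'(2)] sum_distrib_left by (intro sum.cong refl)
    also have "cdet (S - set q) s B = pdet (S - set q) B"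
      by (rule hermitian_cdet(2)[OF assms(1) q'(2)])
    \<comment> \<open>The minor is real, so it can be moved past the walk.\<close>
    also have "?c * \<dots> = \<dots> * ?c"
      by (subst (1 2) hermitian_cdet(1)[OF assms(1)]) (rule of_real_quat_commute[symmetric])
    then have "(-1) ^ length q * ?c * pdet (S - set q) B = - ?f q"
      by (simp add: mult.assoc)
    finally show ?thesis .
  qed
  then show ?thesis
    unfolding cdet_repl_col[OF assms(2)] sum_simple_paths_split[OF assms(4,3)]
    by (simp add: sum_negf)
qed

section \<open>Sums of principal minors\<close>

definition minor_sum :: "nat \<Rightarrow> quat^'n::{finite,linorder}^'n::{finite,linorder} \<Rightarrow> quat" where
  "minor_sum r B = (\<Sum>\<beta>\<in>idx_sets r. pdet \<beta> B)"

text \<open>In the notation of the overview, \<open>minor_sum s B\<close> is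
  \<open>d\<^sub>s\<close> and \<open>repl_minor_sum s k v B\<close> is
  \<open>F\<^sub>s(v)\<close>.\<close>

definition repl_minor_sum :: "nat \<Rightarrow> 'n \<Rightarrow> quat^'n::{finite,linorder} \<Rightarrow> quat^'n::{finite,linorder}^'n::{finite,linorder} \<Rightarrow> quat" where
  "repl_minor_sum r k v B = (\<Sum>\<beta>\<in>idx_sets_with r k. cdet \<beta> k (repl_col k v B))"

lemma mem_idx_sets_with: "\<beta> \<in> idx_sets_with r k \<longleftrightarrow> card \<beta> = r \<and> k \<in> \<beta>"
  by (simp add: idx_sets_with_def idx_sets_def)

lemma sum_idx_sets_with_Suc:
  fixes f :: "'n::finite set \<Rightarrow> 'b::comm_monoid_add"
  assumes "k \<noteq> s"
  shows "(\<Sum>\<beta>\<in>{\<beta> \<in> idx_sets_with (Suc r) k. s \<in> \<beta>}. f \<beta>) =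
    (\<Sum>\<beta>\<in>{\<beta> \<in> idx_sets_with r k. s \<notin> \<beta>}. f (insert s \<beta>))"
  by (rule sum.reindex_bij_witness[where i = "insert s" and j = "\<lambda>\<beta>. \<beta> - {s}"])
    (use assms in \<open>auto simp: mem_idx_sets_with insert_absorb\<close>)

text \<open>This is the comparison of coefficients in Cramer's rule for the matrix \<open>B + \<lambda>I\<close>.\<close>

lemma repl_minor_sum_recursion:
  fixes B :: "quat^'n::{finite,linorder}^'n::{finite,linorder}"
  assumes "hermitian B"
  shows "repl_minor_sum r k (B *v x) B + repl_minor_sum (Suc r) k x B = minor_sum r B * x $ k"
proof -
  have k_in: "k \<in> \<beta>" if "\<beta> \<in> idx_sets_with r k" for \<beta> :: "'n set" and r
    using that by (simp add: mem_idx_sets_with)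
  \<comment> \<open>By right linearity, \<open>c s\<close> is the coefficient of
    \<open>x $ s\<close> on the left-hand side.\<close>
  define c where "c s = (\<Sum>\<beta>\<in>idx_sets_with r k. cdet \<beta> k (repl_col k (column s B) B))
      + (\<Sum>\<beta>\<in>idx_sets_with (Suc r) k. cdet \<beta> k (repl_col k (axis s 1) B))" for s
  have "repl_minor_sum r k (B *v x) B = (\<Sum>s\<in>UNIV. (\<Sum>\<beta>\<in>idx_sets_with r k. cdet \<beta> k (repl_col k (column s B) B)) * x $ s)"
    unfolding repl_minor_sum_def sum_distrib_right
    by (subst sum.swap) (simp add: cdet_repl_col_mult_vec[OF k_in] cong: sum.cong)
  moreover have "repl_minor_sum (Suc r) k x B = (\<Sum>s\<in>UNIV. (\<Sum>\<beta>\<in>idx_sets_with (Suc r) k. cdet \<beta> k (repl_col k (axis s 1) B)) * x $ s)"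
    unfolding repl_minor_sum_def sum_distrib_right
    by (subst sum.swap, intro sum.cong refl cdet_repl_col_axis_sum k_in)
  ultimately have "repl_minor_sum r k (B *v x) B + repl_minor_sum (Suc r) k x B = (\<Sum>s\<in>UNIV. c s * x $ s)"
    unfolding c_def by (simp add: sum.distrib distrib_right)
  also have "\<dots> = (\<Sum>s\<in>UNIV. if s = k then minor_sum r B * x $ s else 0)"
  proof (intro sum.cong refl)
    fix s
    have "c s = (if s = k then minor_sum r B else 0)"
    proof (cases "s = k")
      case True
      \<comment> \<open>The first sum gives the minors of order \<open>r\<close> that contain
        \<open>k\<close>; deleting \<open>k\<close> from the sets of size \<open>Suc r\<close> in
        the second gives those that do not.\<close>
      have "(\<Sum>\<beta>\<in>idx_sets_with r k. cdet \<beta> k (repl_col k (column k B) B)) = (\<Sum>\<beta>\<in>idx_sets_with r k. pdet \<beta> B)"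
        by (intro sum.cong refl) (simp add: hermitian_cdet(2)[OF assms k_in])
      moreover have "(\<Sum>\<beta>\<in>idx_sets_with (Suc r) k. cdet \<beta> k (repl_col k (axis k 1) B)) =
          (\<Sum>\<beta>\<in>idx_sets_with (Suc r) k. pdet (\<beta> - {k}) B)"
        by (intro sum.cong refl cdet_repl_col_axis_same k_in)
      moreover have "\<dots> = (\<Sum>\<beta>\<in>idx_sets r - idx_sets_with r k. pdet \<beta> B)"
        by (rule sum.reindex_bij_witness[where i = "insert k" and j = "\<lambda>\<beta>. \<beta> - {k}"])
          (auto simp: idx_sets_with_def idx_sets_def insert_absorb)
      ultimately show ?thesis
        unfolding True c_def minor_sum_def
        by (simp add: idx_sets_with_def sum.subset_diff[of "{\<alpha> \<in> idx_sets r. k \<in> \<alpha>}" "idx_sets r" "\<lambda>\<beta>. pdet \<beta> B"])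
    next
      case False
      \<comment> \<open>In the first sum, sets containing \<open>s\<close> give two equal columns
        and vanish; in the second, sets missing \<open>s\<close> vanish. Adding \<open>s\<close> to
        the remaining sets matches the two sums with opposite signs.\<close>
      let ?I = "{\<beta> \<in> idx_sets_with r k. s \<notin> \<beta>}"
      have "(\<Sum>\<beta>\<in>idx_sets_with r k. cdet \<beta> k (repl_col k (column s B) B)) =
          (\<Sum>\<beta>\<in>?I. cdet \<beta> k (repl_col k (column s B) B))"
        using False by (intro sum.mono_neutral_right) (auto intro!: cdet_repl_col_other[OF assms] k_in)
      moreover have "(\<Sum>\<beta>\<in>idx_sets_with (Suc r) k. cdet \<beta> k (repl_col k (axis s 1) B)) =
          (\<Sum>\<beta>\<in>{\<beta> \<in> idx_sets_with (Suc r) k. s \<in> \<beta>}. cdet \<beta> k (repl_col k (axis s 1) B))"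
        by (intro sum.mono_neutral_right) (auto intro!: cdet_repl_col_axis_notin k_in)
      moreover have "\<dots> = (\<Sum>\<beta>\<in>?I. - cdet \<beta> k (repl_col k (column s B) B))"
        unfolding sum_idx_sets_with_Suc[OF False[symmetric]]
        by (intro sum.cong refl cdet_repl_col_axis_insert) (auto simp: mem_idx_sets_with)
      ultimately show ?thesis using False by (simp add: c_def sum_negf)
    qed
    then show "c s * x $ s = (if s = k then minor_sum r B * x $ s else 0)" by simp
  qed
  finally show ?thesis by simp
qed

section \<open>Linear algebra over the quaternions\<close>

lemma adj_nth [simp]: "adj A $ i $ j = qcnj (A $ j $ i)"
  by (simp add: adj_def)

lemma adj_adj [simp]: "adj (adj A) = A"
  by (simp add: vec_eq_iff)

lemma adj_mult: "adj (A ** B) = adj B ** adj A"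
  by (simp add: vec_eq_iff matrix_matrix_mult_def)

lemma adj_mat_1 [simp]: "adj (mat 1) = mat 1"
  by (simp add: vec_eq_iff mat_def)

lemma adj_diff: "adj (A - B) = adj A - adj B"
  by (simp add: vec_eq_iff)

lemma hermitian_adj_mult_self: "hermitian (adj A ** A)"
  by (simp add: hermitian_def adj_mult)

lemma matrix_mul_diff_left: "(A - B) ** C = A ** C - B ** (C :: 'a::ring_1^'n^'m)"
  by (simp add: vec_eq_iff matrix_matrix_mult_def left_diff_distrib sum_subtractf)

lemma matrix_mul_diff_right: "C ** (A - B) = C ** A - C ** (B :: 'a::ring_1^'n^'m)"
  by (simp add: vec_eq_iff matrix_matrix_mult_def right_diff_distrib sum_subtractf)

lemma column_mult: "column j (A ** B) = A *v column j B"
  by (simp add: vec_eq_iff column_def matrix_matrix_mult_def matrix_vector_mult_def)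

section \<open>The Hermitian form\<close>

definition hip :: "quat^'n \<Rightarrow> quat^'n \<Rightarrow> quat" where
  "hip x y = (\<Sum>i\<in>UNIV. qcnj (x $ i) * y $ i)"

lemma qcnj_hip [simp]: "qcnj (hip x y) = hip y x"
  by (simp add: hip_def)

lemma hip_mult_vec: "hip x (A *v y) = hip (adj A *v x) y"
  unfolding hip_def matrix_vector_mult_def
  by (simp add: sum_distrib_left sum_distrib_right mult.assoc) (rule sum.swap)

lemma hip_zero [simp]: "hip 0 x = 0" "hip x 0 = 0"
  by (simp_all add: hip_def)

lemma hip_axis: "hip (axis i 1) y = y $ i" "hip x (axis i 1) = qcnj (x $ i)"
  by (simp_all add: hip_def axis_def if_distrib[of qcnj] if_distrib[of "\<lambda>u. u * _"]
      if_distrib[of "\<lambda>u. _ * u"] cong: if_cong)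

lemma QRe_hip_self: "QRe (hip x x) = (\<Sum>i\<in>UNIV. qnorm2 (x $ i))"
  by (simp add: hip_def qcnj_mult_self)

lemma qnorm2_nonneg [simp]: "qnorm2 x \<ge> 0"
  by (simp add: qnorm2_def)

lemma hip_self_pos: "x \<noteq> 0 \<Longrightarrow> QRe (hip x x) > 0"
proof -
  assume "x \<noteq> 0"
  then obtain i where "x $ i \<noteq> 0" by (auto simp: vec_eq_iff)
  then have "qnorm2 (x $ i) > 0" using qnorm2_nonneg[of "x $ i"] by (simp add: less_le)
  then show ?thesis unfolding QRe_hip_self by (intro sum_pos2[of _ i]) auto
qed

lemma hip_self_eq_0_iff: "hip x x = 0 \<longleftrightarrow> x = 0"
  using hip_self_pos by fastforce

lemma adj_mult_nth: "(adj X ** Y) $ i $ j = hip (column i X) (column j Y)"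
  by (simp add: matrix_matrix_mult_def hip_def column_def)

lemma adj_mult_mult_nth: "(adj X ** B ** Y) $ i $ j = hip (column i X) (B *v column j Y)"
  by (simp add: adj_mult_nth column_mult flip: matrix_mul_assoc)

lemma columns_0_imp: "(\<And>j. column j A = 0) \<Longrightarrow> A = 0"
  by (simp add: vec_eq_iff column_def)

lemma adj_mult_self_eq_0: "adj A ** A = 0 \<Longrightarrow> A = (0 :: quat^'n^'m)"
proof (rule columns_0_imp)
  fix j assume "adj A ** A = 0"
  then have "hip (column j A) (column j A) = 0" by (metis adj_mult_nth zero_index)
  then show "column j A = 0" by (simp add: hip_self_eq_0_iff)
qed

text \<open>For Hermitian \<open>P\<close> the form equals its own conjugate, hence is real, and
  positivity can be read off its real part.\<close>

lemma pos_def_iff: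
  "pos_def P \<longleftrightarrow> hermitian P \<and> (\<forall>x. x \<noteq> 0 \<longrightarrow> QRe (hip x (P *v x)) > 0)"
proof -
  have "(\<exists>c::real. c > 0 \<and> hip x (P *v x) = of_real c) \<longleftrightarrow> QRe (hip x (P *v x)) > 0" if "hermitian P" for x
  proof -
    have "qcnj (hip x (P *v x)) = hip x (P *v x)"
      using that by (simp add: hip_mult_vec hermitian_def)
    then have "hip x (P *v x) = of_real (QRe (hip x (P *v x)))" by (simp only: qcnj_eq_self_iff)
    then show ?thesis by (metis QRe_of_real)
  qed
  then show ?thesis unfolding pos_def_def hip_def by blast
qed

section \<open>Linear systems and inverses over a skew field\<close>

lemma homogeneous_system_solution:
  fixes a :: "'i \<Rightarrow> 'j \<Rightarrow> 'a::division_ring"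
  assumes "finite I" "finite J" "card I < card J"
  shows "\<exists>c. (\<exists>j\<in>J. c j \<noteq> 0) \<and> (\<forall>i\<in>I. (\<Sum>j\<in>J. a i j * c j) = 0)"
  using assms
proof (induction I arbitrary: J a rule: finite_induct)
  case empty
  then obtain j where "j \<in> J" by fastforce
  then show ?case by (intro exI[of _ "\<lambda>_. 1"]) auto
next
  case (insert i I)
  show ?case
  proof (cases "\<forall>j\<in>J. a i j = 0")
    case True
    have "card I < card J" using insert.hyps insert.prems by simp
    then obtain c where "\<exists>j\<in>J. c j \<noteq> 0" "\<forall>i\<in>I. (\<Sum>j\<in>J. a i j * c j) = 0"
      using insert.IH[OF insert.prems(1), of a] by blast
    with True show ?thesis by (intro exI[of _ c]) auto
  next
    case False
    then obtain j0 where j0: "j0 \<in> J" "a i j0 \<noteq> 0" by blast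
    \<comment> \<open>Gaussian elimination: equation \<open>i\<close> is solved for the unknown
      \<open>j0\<close> and substituted into the others. The coefficients stand left of the
      unknowns, which fixes the order of the factors in the pivot term.\<close>
    define b where "b i' j = a i' j - a i' j0 * inverse (a i j0) * a i j" for i' j
    have "card I < card (J - {j0})" using insert j0 by simp
    then obtain c where c: "\<exists>j\<in>J - {j0}. c j \<noteq> 0" "\<forall>i'\<in>I. (\<Sum>j\<in>J - {j0}. b i' j * c j) = 0"
      using insert.IH[OF finite_Diff[OF insert.prems(1)], of "{j0}" b] by blast
    define c' where "c' = c(j0 := - inverse (a i j0) * (\<Sum>j\<in>J - {j0}. a i j * c j))"
    have split: "(\<Sum>j\<in>J. a i' j * c' j) = (\<Sum>j\<in>J - {j0}. b i' j * c j)
        + (a i' j0 * inverse (a i j0) * (\<Sum>j\<in>J - {j0}. a i j * c j) + a i' j0 * c' j0)" for i'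
    proof -
      have "(\<Sum>j\<in>J. a i' j * c' j) = a i' j0 * c' j0 + (\<Sum>j\<in>J - {j0}. a i' j * c j)"
        using j0 insert.prems(1) by (subst sum.remove[of _ j0]) (auto simp: c'_def intro!: sum.cong)
      also have "(\<Sum>j\<in>J - {j0}. a i' j * c j) = (\<Sum>j\<in>J - {j0}. b i' j * c j)
          + a i' j0 * inverse (a i j0) * (\<Sum>j\<in>J - {j0}. a i j * c j)"
        unfolding b_def sum_distrib_left by (simp add: sum.distrib[symmetric] algebra_simps)
      finally show ?thesis by (simp add: add_ac)
    qed
    have cancel: "a i' j0 * inverse (a i j0) * s + a i' j0 * c' j0 = 0"
      if "s = (\<Sum>j\<in>J - {j0}. a i j * c j)" for i' s
      unfolding that c'_def by (simp add: mult.assoc)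
    have "b i j = 0" for j using j0 by (simp add: b_def)
    then have "(\<Sum>j\<in>J. a i' j * c' j) = 0" if "i' \<in> insert i I" for i'
      using that c(2) unfolding split cancel[OF refl] by auto
    moreover have "\<exists>j\<in>J. c' j \<noteq> 0" using c(1) by (auto simp: c'_def)
    ultimately show ?thesis by blast
  qed
qed

text \<open>With \<open>y\<close> adjoined as an extra column, labelled \<open>None\<close>, there
  is one more unknown than equations and hence a nontrivial solution. Injectivity forces its
  \<open>None\<close> coefficient to be nonzero, and dividing by it solves the system.\<close>

lemma solve_on_indices:
  fixes B :: "quat^'n^'n" and y :: "quat^'n" and S :: "'n set"
  assumes inj: "\<And>x. (\<And>i. i \<notin> S \<Longrightarrow> x $ i = 0) \<Longrightarrow> (\<And>i. i \<in> S \<Longrightarrow> (B *v x) $ i = 0) \<Longrightarrow> x = 0"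
  obtains x where "\<And>i. i \<notin> S \<Longrightarrow> x $ i = 0" "\<And>i. i \<in> S \<Longrightarrow> (B *v x) $ i = y $ i"
proof -
  define a where "a i j = (case j of None \<Rightarrow> y $ i | Some j \<Rightarrow> B $ i $ j)" for i :: 'n and j
  define J where "J = insert None (Some ` S)"
  have "card S < card J" by (simp add: J_def card_image)
  then obtain c where c: "\<exists>j\<in>J. c j \<noteq> 0" "\<forall>i\<in>S. (\<Sum>j\<in>J. a i j * c j) = 0"
    using homogeneous_system_solution[of S J a] by (auto simp: J_def)
  define z where "z r = (\<chi> j. if j \<in> S then c (Some j) * r else 0)" for r :: quat
  have Bz: "(B *v z r) $ i = (\<Sum>j\<in>S. B $ i $ j * c (Some j)) * r" for i r
    unfolding matrix_vector_mult_def z_def sum_distrib_right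
    by (simp add: if_distrib[of "\<lambda>u. _ * u"] sum.If_cases mult.assoc cong: if_cong)
  have sumJ: "y $ i * c None + (\<Sum>j\<in>S. B $ i $ j * c (Some j)) = 0" if "i \<in> S" for i
    using c(2) that by (simp add: J_def a_def sum.reindex)
  have cN: "c None \<noteq> 0"
  proof
    assume 0: "c None = 0"
    then have "(B *v z 1) $ i = 0" if "i \<in> S" for i using sumJ[OF that] by (simp add: Bz)
    then have "z 1 = 0" by (intro inj) (simp_all add: z_def)
    then have "c (Some j) = 0" if "j \<in> S" for j using that by (auto simp: z_def vec_eq_iff split: if_splits)
    with 0 c(1) show False by (auto simp: J_def)
  qed
  have sol: "(B *v z (- inverse (c None))) $ i = y $ i" if "i \<in> S" for i
  proof -
    have "(\<Sum>j\<in>S. B $ i $ j * c (Some j)) = - (y $ i * c None)"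
      using sumJ[OF that] by (simp add: eq_neg_iff_add_eq_0 add.commute)
    then show ?thesis unfolding Bz using cN by (simp add: mult.assoc)
  qed
  show thesis by (rule that[of "z (- inverse (c None))"]) (simp_all add: sol, simp add: z_def)
qed

lemma matrix_inverse_unique:
  fixes A :: "'a::semiring_1^'n^'n"
  assumes "A ** B = mat 1" "C ** A = mat 1"
  shows "B = C"
proof -
  have "B = (C ** A) ** B" by (simp add: assms)
  also have "\<dots> = C ** (A ** B)" by (rule matrix_mul_assoc[symmetric])
  finally show ?thesis by (simp add: assms)
qed

text \<open>Solving for the unit vectors gives a right inverse \<open>B\<close>. Since
  \<open>A ** B = mat 1\<close>, \<open>B\<close> is injective and has a right inverse as well,
  which must be \<open>A\<close>.\<close>

lemma injective_imp_inverse: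
  fixes A :: "quat^'n^'n"
  assumes "\<And>x. A *v x = 0 \<Longrightarrow> x = 0"
  obtains B where "A ** B = mat 1" "B ** A = mat 1"
proof -
  have right: "\<exists>B. A ** B = mat 1" if A: "\<And>x. A *v x = 0 \<Longrightarrow> x = 0" for A :: "quat^'n^'n"
  proof -
    have "\<exists>x. A *v x = y" for y
    proof (rule solve_on_indices[of UNIV A y])
      fix x assume "\<And>i. i \<in> UNIV \<Longrightarrow> (A *v x) $ i = 0"
      then have "A *v x = 0" by (simp add: vec_eq_iff)
      then show "x = 0" by (rule A)
    next
      fix x assume "\<And>i. i \<in> UNIV \<Longrightarrow> (A *v x) $ i = y $ i"
      then have "A *v x = y" by (simp add: vec_eq_iff)
      then show "\<exists>x. A *v x = y" ..
    qed
    then obtain X where X: "\<And>y. A *v X y = y" by metis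
    define B where "B = (\<chi> i j. X (axis j 1) $ i)"
    have "(A ** B) $ i $ j = mat 1 $ i $ j" for i j
    proof -
      have "column j B = X (axis j 1)" by (simp add: B_def column_def vec_eq_iff)
      then have "column j (A ** B) = axis j 1" by (simp add: column_mult X)
      then have "column j (A ** B) $ i = axis j 1 $ i" by (simp only:)
      then show ?thesis by (simp add: axis_def column_def mat_def)
    qed
    then have "A ** B = mat 1" by (simp add: vec_eq_iff)
    then show ?thesis ..
  qed
  obtain B where AB: "A ** B = mat 1" using right[OF assms] by blast
  have "x = 0" if "B *v x = 0" for x
  proof -
    have "x = A *v (B *v x)" by (simp add: matrix_vector_mul_assoc AB)
    then show ?thesis by (simp add: that)
  qed
  then obtain C where BC: "B ** C = mat 1" using right[of B] by blast
  have "C = A" using BC AB by (rule matrix_inverse_unique)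
  with AB BC that show thesis by blast
qed

lemma pos_def_injective: "pos_def P \<Longrightarrow> P *v x = 0 \<Longrightarrow> x = 0"
  unfolding pos_def_iff by (metis hip_zero(2) less_irrefl zero_quat.simps(1))

lemma matrix_inv_eqI:
  fixes A :: "'a::semiring_1^'n^'n"
  assumes "A ** B = mat 1" "B ** A = mat 1"
  shows "matrix_inv A = B"
proof -
  have "A ** matrix_inv A = mat 1 \<and> matrix_inv A ** A = mat 1"
    unfolding matrix_inv_def using assms by (intro someI_ex[of "\<lambda>X. A ** X = mat 1 \<and> X ** A = mat 1"]) blast
  then show ?thesis using assms(2) matrix_inverse_unique by blast
qed

lemma pos_def_inverse:
  assumes "pos_def P"
  shows "P ** matrix_inv P = mat 1" "matrix_inv P ** P = mat 1"
proof -
  obtain B where "P ** B = mat 1" "B ** P = mat 1"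
    using injective_imp_inverse[of P] pos_def_injective[OF assms] by blast
  then show "P ** matrix_inv P = mat 1" "matrix_inv P ** P = mat 1"
    using matrix_inv_eqI by metis+
qed

lemma hermitian_inverse:
  assumes "hermitian P" "P ** Q = mat 1" "Q ** P = mat 1"
  shows "hermitian Q"
proof -
  have "adj Q ** P = mat 1" using assms by (metis adj_mat_1 adj_mult hermitian_def)
  then have "Q = adj Q" by (rule matrix_inverse_unique[OF assms(2)])
  then show ?thesis by (simp only: hermitian_def)
qed

lemma pos_def_matrix_inv:
  assumes "pos_def P"
  shows "pos_def (matrix_inv P)" "matrix_inv (matrix_inv P) = P"
proof -
  note inv = pos_def_inverse[OF assms]
  show "matrix_inv (matrix_inv P) = P" using inv by (intro matrix_inv_eqI)
  have P: "hermitian P" "\<And>x. x \<noteq> 0 \<Longrightarrow> QRe (hip x (P *v x)) > 0"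
    using assms by (auto simp: pos_def_iff)
  have h: "hermitian (matrix_inv P)" using P(1) inv by (rule hermitian_inverse)
  moreover have "QRe (hip x (matrix_inv P *v x)) > 0" if "x \<noteq> 0" for x
  proof -
    let ?y = "matrix_inv P *v x"
    have "P *v ?y = x" using inv by (simp add: matrix_vector_mul_assoc)
    then have "?y \<noteq> 0" using that by auto
    then have "QRe (hip ?y (P *v ?y)) > 0" by (rule P(2))
    then show ?thesis using \<open>P *v ?y = x\<close> h by (simp add: hip_mult_vec hermitian_def)
  qed
  ultimately show "pos_def (matrix_inv P)" by (simp add: pos_def_iff)
qed

section \<open>Rank\<close>

lemma right_indep_cols_iff:
  "right_indep_cols A S \<longleftrightarrow> (\<forall>x. (\<forall>j. j \<notin> S \<longrightarrow> x $ j = 0) \<longrightarrow> A *v x = 0 \<longrightarrow> x = 0)"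
proof -
  define z where "z c = (\<chi> j. if j \<in> S then c j else 0)" for c :: "'a \<Rightarrow> quat"
  have Az: "(A *v z c) $ i = (\<Sum>j\<in>S. A $ i $ j * c j)" for c i
    unfolding matrix_vector_mult_def z_def
    by (simp add: if_distrib[of "\<lambda>u. _ * u"] sum.If_cases cong: if_cong)
  have z0: "z c = 0 \<longleftrightarrow> (\<forall>j\<in>S. c j = 0)" for c
    by (auto simp: z_def vec_eq_iff)
  have "right_indep_cols A S \<longleftrightarrow> (\<forall>c. A *v z c = 0 \<longrightarrow> z c = 0)"
    unfolding right_indep_cols_def z0 by (simp add: vec_eq_iff Az)
  also have "\<dots> \<longleftrightarrow> (\<forall>x. (\<forall>j. j \<notin> S \<longrightarrow> x $ j = 0) \<longrightarrow> A *v x = 0 \<longrightarrow> x = 0)"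
  proof (intro iffI allI impI)
    fix x assume "\<forall>c. A *v z c = 0 \<longrightarrow> z c = 0" "\<forall>j. j \<notin> S \<longrightarrow> x $ j = 0" "A *v x = 0"
    moreover from this have "z (\<lambda>j. x $ j) = x" by (simp add: z_def vec_eq_iff)
    ultimately show "x = 0" by metis
  next
    fix c assume "\<forall>x. (\<forall>j. j \<notin> S \<longrightarrow> x $ j = 0) \<longrightarrow> A *v x = 0 \<longrightarrow> x = 0" "A *v z c = 0"
    then show "z c = 0" by (simp add: z_def)
  qed
  finally show ?thesis .
qed

lemma finite_indep_cards: "finite {card S | S. right_indep_cols A S}"
  by (rule finite_subset[of _ "card ` UNIV"]) auto

lemma card_le_qrank: "right_indep_cols A S \<Longrightarrow> card S \<le> qrank A"
  unfolding qrank_def using finite_indep_cards by (intro Max_ge) blast+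

lemma qrank_witness: obtains S where "right_indep_cols A S" "card S = qrank A"
proof -
  have "right_indep_cols A {}" by (simp add: right_indep_cols_def)
  then have "qrank A \<in> {card S | S. right_indep_cols A S}"
    unfolding qrank_def using finite_indep_cards by (intro Max_in) blast+
  with that show thesis by auto
qed

lemma qrank_cong:
  "(\<And>S. right_indep_cols A S \<longleftrightarrow> right_indep_cols B S) \<Longrightarrow> qrank A = qrank B"
  by (simp add: qrank_def)

lemma qrank_mult_left:
  assumes "P' ** P = mat 1"
  shows "qrank (P ** A) = qrank A"
proof (rule qrank_cong)
  have "(P ** A) *v x = 0 \<longleftrightarrow> A *v x = 0" for x
    using assms by (metis matrix_mul_assoc matrix_mul_lid matrix_vector_mul_assoc matrix_vector_mult_0_right)
  then show "right_indep_cols (P ** A) S \<longleftrightarrow> right_indep_cols A S" for S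
    by (simp add: right_indep_cols_iff)
qed

text \<open>A maximal independent set \<open>T\<close> of columns spans all columns, which factors
  \<open>A\<close> through a space of dimension \<open>card T\<close>. If \<open>adj A\<close> had
  more than \<open>card T\<close> independent columns, a homogeneous system with one equation for
  each element of \<open>T\<close> would produce a dependency among them.\<close>

lemma qrank_adj_le: "qrank (adj A) \<le> qrank A"
proof -
  obtain T where T: "right_indep_cols A T" "card T = qrank A" by (rule qrank_witness)
  have "\<exists>c. \<forall>i. A $ i $ j = (\<Sum>t\<in>T. A $ i $ t * c t)" for j
  proof (cases "j \<in> T")
    case True
    then show ?thesis
      by (intro exI[of _ "\<lambda>t. if t = j then 1 else 0"]) (simp add: if_distrib[of "\<lambda>u. _ * u"] cong: if_cong)
  next
    case False
    then have "card (insert j T) > qrank A" using T(2) by simp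
    then have "\<not> right_indep_cols A (insert j T)" using card_le_qrank[of A "insert j T"] by auto
    then obtain c where c: "\<And>i. (\<Sum>t\<in>insert j T. A $ i $ t * c t) = 0" "\<exists>t\<in>insert j T. c t \<noteq> 0"
      unfolding right_indep_cols_def by blast
    have sum: "A $ i $ j * c j = - (\<Sum>t\<in>T. A $ i $ t * c t)" for i
      using c(1)[of i] False by (simp add: eq_neg_iff_add_eq_0)
    have "c j \<noteq> 0"
    proof
      assume "c j = 0"
      then have "\<forall>i. (\<Sum>t\<in>T. A $ i $ t * c t) = 0" using sum by simp
      then have "\<forall>t\<in>T. c t = 0" using T(1) unfolding right_indep_cols_def by blast
      with \<open>c j = 0\<close> c(2) show False by blast
    qed
    then have "A $ i $ j = A $ i $ j * c j * inverse (c j)" for i by (simp add: mult.assoc)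
    then have "A $ i $ j = (\<Sum>t\<in>T. A $ i $ t * (- (c t * inverse (c j))))" for i
      unfolding sum by (simp add: sum_distrib_right mult.assoc sum_negf)
    then show ?thesis by (intro exI[of _ "\<lambda>t. - (c t * inverse (c j))"]) blast
  qed
  then obtain V where V: "\<And>i j. A $ i $ j = (\<Sum>t\<in>T. A $ i $ t * V j t)" by metis
  obtain S where S: "right_indep_cols (adj A) S" "card S = qrank (adj A)" by (rule qrank_witness)
  have "\<not> card T < card S"
  proof
    assume "card T < card S"
    then obtain c where c: "\<exists>i\<in>S. c i \<noteq> 0" "\<forall>t\<in>T. (\<Sum>i\<in>S. qcnj (A $ i $ t) * c i) = 0"
      using homogeneous_system_solution[of T S "\<lambda>t i. qcnj (A $ i $ t)"] by auto
    have "(\<Sum>i\<in>S. adj A $ j $ i * c i) = 0" for j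
    proof -
      have "(\<Sum>i\<in>S. adj A $ j $ i * c i) = (\<Sum>i\<in>S. \<Sum>t\<in>T. qcnj (V j t) * (qcnj (A $ i $ t) * c i))"
        by (subst adj_nth, subst V) (simp add: sum_distrib_right mult.assoc)
      also have "\<dots> = (\<Sum>t\<in>T. qcnj (V j t) * (\<Sum>i\<in>S. qcnj (A $ i $ t) * c i))"
        unfolding sum_distrib_left by (rule sum.swap)
      also have "\<dots> = 0" using c(2) by simp
      finally show ?thesis .
    qed
    with S(1) c(1) show False unfolding right_indep_cols_def by blast
  qed
  then show ?thesis using T S by simp
qed

lemma qrank_adj: "qrank (adj A) = qrank A"
  using qrank_adj_le[of A] qrank_adj_le[of "adj A"] by simp

lemma qrank_mult_right:
  assumes "P ** P' = mat 1"
  shows "qrank (A ** P) = qrank A"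
proof -
  have "adj P' ** adj P = mat 1" using assms by (metis adj_mat_1 adj_mult)
  then have "qrank (adj (A ** P)) = qrank (adj A)" unfolding adj_mult by (rule qrank_mult_left)
  then show ?thesis by (simp add: qrank_adj)
qed

section \<open>Diagonalisation and square roots\<close>

instantiation quat :: real_inner
begin

definition inner_quat :: "quat \<Rightarrow> quat \<Rightarrow> real" where
  "inner_quat x y = QRe x * QRe y + QI x * QI y + QJ x * QJ y + QK x * QK y"

definition norm_quat :: "quat \<Rightarrow> real" where
  "norm_quat x = sqrt (inner x x)"

definition sgn_quat :: "quat \<Rightarrow> quat" where
  "sgn_quat x = x /\<^sub>R norm x"

definition dist_quat :: "quat \<Rightarrow> quat \<Rightarrow> real" where
  "dist_quat x y = norm (x - y)"

definition uniformity_quat :: "(quat \<times> quat) filter" where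
  "uniformity_quat = (INF e\<in>{0 <..}. principal {(x, y). dist x y < e})"

definition open_quat :: "quat set \<Rightarrow> bool" where
  "open_quat U \<longleftrightarrow> (\<forall>x\<in>U. eventually (\<lambda>(x', y). x' = x \<longrightarrow> y \<in> U) uniformity)"

instance
proof
  fix x y z :: quat and r :: real and U :: "quat set"
  show "dist x y = norm (x - y)" by (rule dist_quat_def)
  show "sgn x = x /\<^sub>R norm x" by (rule sgn_quat_def)
  show "uniformity = (INF e\<in>{0 <..}. principal {(x, y :: quat). dist x y < e})" by (rule uniformity_quat_def)
  show "open U \<longleftrightarrow> (\<forall>x\<in>U. eventually (\<lambda>(x', y). x' = x \<longrightarrow> y \<in> U) uniformity)" by (rule open_quat_def)
  show "inner x y = inner y x" by (simp add: inner_quat_def mult.commute)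
  show "inner (x + y) z = inner x z + inner y z" by (simp add: inner_quat_def algebra_simps)
  show "inner (scaleR r x) y = r * inner x y" by (simp add: inner_quat_def algebra_simps)
  show "0 \<le> inner x x" by (simp add: inner_quat_def)
  show "inner x x = 0 \<longleftrightarrow> x = 0"
    by (auto simp: inner_quat_def quat_eq_iff add_nonneg_eq_0_iff)
  show "norm x = sqrt (inner x x)" by (rule norm_quat_def)
qed

end

lemma norm_quat_conv: "norm x = sqrt (qnorm2 x)"
  by (simp add: norm_quat_def inner_quat_def qnorm2_def power2_eq_square)

instance quat :: real_normed_div_algebra
proof
  fix x y :: quat
  have "qnorm2 (x * y) = qnorm2 x * qnorm2 y"
    by (simp add: qnorm2_def power2_eq_square algebra_simps)
  then show "norm (x * y) = norm x * norm y"
    by (simp add: norm_quat_conv real_sqrt_mult)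
qed

instantiation quat :: euclidean_space
begin

definition Basis_quat :: "quat set" where
  "Basis_quat = {Quat 1 0 0 0, Quat 0 1 0 0, Quat 0 0 1 0, Quat 0 0 0 1}"

instance
proof
  show "(Basis :: quat set) \<noteq> {}" "finite (Basis :: quat set)"
    by (simp_all add: Basis_quat_def)
  fix x y :: quat
  show "x \<in> Basis \<Longrightarrow> y \<in> Basis \<Longrightarrow> inner x y = (if x = y then 1 else 0)"
    unfolding Basis_quat_def inner_quat_def
    by (elim insertE emptyE; simp only: quat.sel quat.inject; simp)
  show "(\<forall>u\<in>Basis. inner x u = 0) \<longleftrightarrow> x = 0"
    unfolding Basis_quat_def inner_quat_def quat_eq_iff
    by (simp only: ball_simps quat.sel zero_quat.sel; simp)
qed

end

lemma qnorm2_eq_norm: "qnorm2 x = (norm x)\<^sup>2"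
  by (simp add: norm_quat_conv)

lemma continuous_on_qcnj [continuous_intros]:
  fixes f :: "'a::topological_space \<Rightarrow> quat"
  assumes "continuous_on S f"
  shows "continuous_on S (\<lambda>x. qcnj (f x))"
proof -
  have "linear qcnj" by (rule linearI) simp_all
  then have "bounded_linear qcnj" by (simp only: linear_conv_bounded_linear)
  then show ?thesis using assms by (rule bounded_linear.continuous_on)
qed

lemma continuous_on_QRe [continuous_intros]:
  fixes f :: "'a::topological_space \<Rightarrow> quat"
  assumes "continuous_on S f"
  shows "continuous_on S (\<lambda>x. QRe (f x))"
proof -
  have "linear QRe" by (rule linearI) simp_all
  then have "bounded_linear QRe" by (simp only: linear_conv_bounded_linear)
  then show ?thesis using assms by (rule bounded_linear.continuous_on)
qed

lemma continuous_on_matrix_nth [continuous_intros]: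
  "continuous_on S (\<lambda>U :: quat^'n^'m. U $ i $ j)"
  by (rule bounded_linear.continuous_on[OF bounded_linear_vec_nth])
    (rule bounded_linear.continuous_on[OF bounded_linear_vec_nth continuous_on_id])

text \<open>The set is closed because it is cut out by continuous equations in the entries, and
  bounded because its matrices have columns of norm 1. Compactness supplies the maximiser in the
  diagonalisation.\<close>

lemma compact_isometries: "compact {U :: quat^'n^'m. adj U ** U = mat 1}"
proof -
  let ?K = "{U :: quat^'n^'m. adj U ** U = mat 1}"
  have "?K = (\<Inter>i. \<Inter>j. {U. (\<Sum>k\<in>UNIV. qcnj (U $ k $ i) * U $ k $ j) = (if i = j then 1 else 0)})"
    by (auto simp: vec_eq_iff matrix_matrix_mult_def mat_def)
  moreover have "closed \<dots>"
    by (intro closed_INT ballI closed_Collect_eq continuous_intros)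
  ultimately have "closed ?K" by simp
  moreover have "bounded ?K"
    unfolding bounded_iff
  proof (intro exI ballI)
    fix U :: "quat^'n^'m" assume "U \<in> ?K"
    then have U: "(adj U ** U) $ j $ j = 1" for j by (simp add: mat_def)
    have entry: "norm (U $ i $ j) \<le> 1" for i j
    proof -
      have "qnorm2 (U $ i $ j) \<le> (\<Sum>k\<in>UNIV. qnorm2 (U $ k $ j))"
        by (rule member_le_sum) auto
      also have "\<dots> = QRe ((adj U ** U) $ j $ j)"
        by (simp add: adj_mult_nth QRe_hip_self column_def)
      also have "\<dots> = 1" by (simp add: U)
      finally show ?thesis by (simp add: norm_quat_conv)
    qed
    have "norm U \<le> (\<Sum>i\<in>UNIV. norm (U $ i))" unfolding norm_vec_def by (rule L2_set_le_sum) simp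
    also have "\<dots> \<le> (\<Sum>i\<in>(UNIV :: 'm set). \<Sum>j\<in>(UNIV :: 'n set). 1)"
    proof (rule sum_mono)
      fix i
      have "norm (U $ i) \<le> (\<Sum>j\<in>UNIV. norm (U $ i $ j))" unfolding norm_vec_def by (rule L2_set_le_sum) simp
      also have "\<dots> \<le> (\<Sum>j\<in>(UNIV :: 'n set). 1)" by (intro sum_mono entry)
      finally show "norm (U $ i) \<le> (\<Sum>j\<in>(UNIV :: 'n set). 1)" .
    qed
    finally show "norm U \<le> (\<Sum>i\<in>(UNIV :: 'm set). \<Sum>j\<in>(UNIV :: 'n set). 1)" .
  qed
  ultimately show ?thesis by (simp add: compact_eq_bounded_closed)
qed

section \<open>Unitary diagonalisation of Hermitian matrices\<close>

definition qdiag :: "('n \<Rightarrow> real) \<Rightarrow> quat^'n^'n" where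
  "qdiag d = (\<chi> i j. if i = j then of_real (d i) else 0)"

lemma qdiag_mult: "qdiag d ** qdiag e = qdiag (\<lambda>i. d i * e i)"
  by (simp add: qdiag_def vec_eq_iff matrix_matrix_mult_def if_distrib[of "\<lambda>u. _ * u"]
      if_distrib[of "\<lambda>u. u * _"] cong: if_cong)

lemma adj_qdiag [simp]: "adj (qdiag d) = qdiag d"
  by (simp add: qdiag_def vec_eq_iff)

lemma hip_qdiag: "QRe (hip x (qdiag d *v x)) = (\<Sum>i\<in>UNIV. d i * qnorm2 (x $ i))"
proof -
  have "(qdiag d *v x) $ i = d i *\<^sub>R x $ i" for i
    by (simp add: qdiag_def matrix_vector_mult_def if_distrib[of "\<lambda>u. u * _"] of_real_def cong: if_cong)
  then show ?thesis by (simp add: hip_def qcnj_mult_self)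
qed

definition vec2 :: "'n \<Rightarrow> 'n \<Rightarrow> quat \<Rightarrow> quat \<Rightarrow> quat^'n" where
  "vec2 p q a b = (\<chi> k. if k = p then a else if k = q then b else 0)"

lemma hip_vec2:
  assumes "p \<noteq> q"
  shows "hip (vec2 p q a b) y = qcnj a * y $ p + qcnj b * y $ q"
proof -
  have "hip (vec2 p q a b) y = (\<Sum>k\<in>{p, q}. qcnj (vec2 p q a b $ k) * y $ k)"
    unfolding hip_def by (rule sum.mono_neutral_right) (auto simp: vec2_def)
  then show ?thesis using assms by (simp add: vec2_def)
qed

lemma mult_vec2:
  assumes "p \<noteq> q"
  shows "(B *v vec2 p q a b) $ i = B $ i $ p * a + B $ i $ q * b"
proof -
  have "(B *v vec2 p q a b) $ i = (\<Sum>k\<in>{p, q}. B $ i $ k * vec2 p q a b $ k)"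
    unfolding matrix_vector_mult_def by simp (rule sum.mono_neutral_right; auto simp: vec2_def)
  then show ?thesis using assms by (simp add: vec2_def)
qed

text \<open>A rotation in the coordinates \<open>p\<close> and \<open>q\<close> preserves the sum of
  these two diagonal entries and leaves the others alone, so it suffices to raise the entry at
  \<open>p\<close>, which has the larger weight.\<close>

lemma plane_rotation:
  fixes B :: "quat^'n^'n"
  assumes B: "hermitian B" and pq: "p \<noteq> q" and b: "B $ p $ q \<noteq> 0" and w: "w q < (w p :: real)"
  obtains G where "adj G ** G = mat 1"
    "(\<Sum>i\<in>UNIV. w i * QRe ((adj G ** B ** G) $ i $ i)) > (\<Sum>i\<in>UNIV. w i * QRe (B $ i $ i))"
proof -
  define \<beta> where "\<beta> = norm (B $ p $ q)"
  \<comment> \<open>\<open>u\<close> is the unit phase of \<open>B $ p $ q\<close>; with it built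
    into the rotation the cross terms become the real number
    \<open>2 * c * s * \<beta>\<close>.\<close>
  define u where "u = B $ p $ q /\<^sub>R \<beta>"
  define D where "D = QRe (B $ p $ p) - QRe (B $ q $ q)"
  \<comment> \<open>\<open>t\<close> is the tangent of the rotation angle. This size gives
    \<open>t * D \<le> \<beta> < 2 * \<beta>\<close>, so the first-order gain outweighs the
    second-order term in \<open>D\<close>.\<close>
  define t where "t = \<beta> / (\<bar>D\<bar> + 1)"
  define c where "c = 1 / sqrt (1 + t\<^sup>2)"
  define s where "s = t * c"
  have \<beta>: "\<beta> > 0" using b by (simp add: \<beta>_def)
  have qn: "qnorm2 (B $ p $ q) = \<beta>\<^sup>2" by (simp add: \<beta>_def qnorm2_eq_norm)
  have c2: "c\<^sup>2 = 1 / (1 + t\<^sup>2)"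
    by (simp add: c_def power_divide add_nonneg_nonneg)
  have "c\<^sup>2 > 0" unfolding c2 by (simp add: add_pos_nonneg)
  have "1 + t\<^sup>2 \<noteq> 0" by (metis add_pos_nonneg less_irrefl zero_le_power2 zero_less_one)
  then have cs: "c\<^sup>2 + s\<^sup>2 = 1"
    unfolding s_def power_mult_distrib c2 by (simp add: field_simps)
  have gain: "2 * c * s * \<beta> - s\<^sup>2 * D > 0"
  proof -
    have tD: "t * D < 2 * \<beta>"
    proof -
      have "t * D \<le> t * \<bar>D\<bar>" using \<beta> by (intro mult_left_mono) (auto simp: t_def)
      also have "\<dots> \<le> t * (\<bar>D\<bar> + 1)" using \<beta> by (intro mult_left_mono) (auto simp: t_def)
      also have "\<dots> = \<beta>" by (simp add: t_def)
      finally show ?thesis using \<beta> by simp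
    qed
    have "t > 0" using \<beta> by (simp add: t_def)
    then have "0 < c\<^sup>2 * (t * (2 * \<beta> - t * D))" using \<open>c\<^sup>2 > 0\<close> tD by simp
    then show ?thesis by (simp add: s_def power2_eq_square algebra_simps)
  qed
  have "inverse \<beta> * (inverse \<beta> * (\<beta> * \<beta>)) = 1" using \<beta> by (simp add: field_simps)
  then have uu: "u * qcnj u = 1" "qcnj u * u = 1"
    unfolding u_def by (simp_all add: mult_qcnj_self qcnj_mult_self qn power2_eq_square)
  have bu: "B $ p $ q = \<beta> *\<^sub>R u" using \<beta> by (simp add: u_def)
  then have bu': "B $ q $ p = \<beta> *\<^sub>R qcnj u" using hermitian_nth[OF B, of p q] by simp
  have "B $ p $ p = of_real (QRe (B $ p $ p))" "B $ q $ q = of_real (QRe (B $ q $ q))"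
    using hermitian_nth[OF B] qcnj_eq_self_iff by blast+
  then obtain bp bq where bpq: "B $ p $ p = bp *\<^sub>R 1" "B $ q $ q = bq *\<^sub>R 1"
    unfolding of_real_def by blast
  define g where "g i = (if i = p then vec2 p q (c *\<^sub>R 1) (s *\<^sub>R qcnj u)
    else if i = q then vec2 p q (- (s *\<^sub>R u)) (c *\<^sub>R 1) else axis i 1)" for i
  define G where "G = (\<chi> k i. g i $ k)"
  have col: "column i G = g i" for i by (simp add: G_def column_def vec_eq_iff)
  have "(adj G ** G) $ i $ j = mat 1 $ i $ j" for i j
  proof -
    have "hip (g i) (g j) = (if i = j then 1 else 0)"
    proof (cases "i \<in> {p, q} \<and> j \<in> {p, q}")
      case True
      have cs': "(c * c) *\<^sub>R 1 + (s * s) *\<^sub>R 1 = (1 :: quat)"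
        using cs by (simp add: power2_eq_square flip: scaleR_left.add)
      have gp: "hip (g p) y = c *\<^sub>R y $ p + s *\<^sub>R (u * y $ q)" for y
        using pq by (simp add: g_def hip_vec2)
      have gq: "hip (g q) y = c *\<^sub>R y $ q - s *\<^sub>R (qcnj u * y $ p)" for y
        using pq by (simp add: g_def hip_vec2)
      have "g p $ p = c *\<^sub>R 1" "g p $ q = s *\<^sub>R qcnj u" "g q $ p = - (s *\<^sub>R u)" "g q $ q = c *\<^sub>R 1"
        using pq by (simp_all add: g_def vec2_def)
      then have "hip (g p) (g p) = 1" "hip (g q) (g q) = 1" "hip (g p) (g q) = 0" "hip (g q) (g p) = 0"
        unfolding gp gq using cs' by (simp_all add: uu mult.commute add.commute)
      with True pq show ?thesis by auto
    next
      case False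
      then show ?thesis using pq
        by (auto simp: g_def hip_axis) (auto simp: vec2_def axis_def)
    qed
    then show ?thesis by (simp add: adj_mult_nth col mat_def)
  qed
  then have "adj G ** G = mat 1" by (simp add: vec_eq_iff)
  moreover have "(\<Sum>i\<in>UNIV. w i * QRe ((adj G ** B ** G) $ i $ i)) > (\<Sum>i\<in>UNIV. w i * QRe (B $ i $ i))"
  proof -
    define e where "e i = QRe ((adj G ** B ** G) $ i $ i) - QRe (B $ i $ i)" for i
    have e: "e i = QRe (hip (g i) (B *v g i)) - QRe (B $ i $ i)" for i
      by (simp add: e_def adj_mult_mult_nth col)
    have Bcol: "(B *v axis i 1) $ i = B $ i $ i" for i
      by (simp add: matrix_vector_mult_def axis_def if_distrib[of "\<lambda>u. _ * u"] cong: if_cong)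
    have e0: "e i = 0" if "i \<noteq> p" "i \<noteq> q" for i
      using that by (simp add: e g_def hip_axis Bcol)
    have ep: "e p = 2 * c * s * \<beta> - s\<^sup>2 * D"
    proof -
      have "QRe (hip (g p) (B *v g p)) = c\<^sup>2 * bp + s\<^sup>2 * bq + 2 * c * s * \<beta>"
        using pq by (simp add: g_def hip_vec2 mult_vec2 bu bu' bpq distrib_left uu power2_eq_square)
      then have "e p = c\<^sup>2 * bp + s\<^sup>2 * bq + 2 * c * s * \<beta> - (c\<^sup>2 + s\<^sup>2) * bp"
        unfolding e cs by (simp add: bpq)
      then show ?thesis by (simp add: D_def bpq algebra_simps)
    qed
    have eq: "e q = - (2 * c * s * \<beta> - s\<^sup>2 * D)"
    proof -
      have "QRe (hip (g q) (B *v g q)) = s\<^sup>2 * bp + c\<^sup>2 * bq - 2 * c * s * \<beta>"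
        using pq by (simp add: g_def hip_vec2 mult_vec2 bu bu' bpq right_diff_distrib uu power2_eq_square)
      then have "e q = s\<^sup>2 * bp + c\<^sup>2 * bq - 2 * c * s * \<beta> - (c\<^sup>2 + s\<^sup>2) * bq"
        unfolding e cs by (simp add: bpq)
      then show ?thesis by (simp add: D_def bpq algebra_simps)
    qed
    have "(\<Sum>i\<in>UNIV. w i * e i) = (\<Sum>i\<in>{p, q}. w i * e i)"
      using e0 by (intro sum.mono_neutral_right) auto
    also have "\<dots> = (w p - w q) * (2 * c * s * \<beta> - s\<^sup>2 * D)"
      using pq by (simp add: ep eq algebra_simps)
    also have "\<dots> > 0" using gain w by simp
    finally have "(\<Sum>i\<in>UNIV. w i * e i) > 0" .
    then show ?thesis by (simp add: e_def right_diff_distrib sum_subtractf)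
  qed
  ultimately show thesis by (rule that)
qed

text \<open>Diagonalisation: maximise \<open>\<Sum>i. w i * (U\<^sup>* P U)\<^sub>i\<^sub>i\<close> over unitary \<open>U\<close>, for distinct weights \<open>w i\<close>.
  A rotation in a coordinate plane with a nonzero off-diagonal entry would increase it.\<close>

theorem hermitian_diagonalization:
  fixes P :: "quat^'n^'n"
  assumes P: "hermitian P"
  obtains U :: "quat^'n^'n" and d where "adj U ** U = mat 1" "U ** adj U = mat 1" "P = U ** qdiag d ** adj U"
proof -
  obtain w :: "'n \<Rightarrow> nat" where w: "inj w"
    using finite_imp_inj_to_nat_seg[OF finite[of "UNIV :: 'n set"]] by blast
  define f where "f U = (\<Sum>i\<in>UNIV. real (w i) * QRe ((adj U ** P ** U) $ i $ i))" for U :: "quat^'n^'n"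
  let ?K = "{U :: quat^'n^'n. adj U ** U = mat 1}"
  have "f = (\<lambda>U. \<Sum>i\<in>UNIV. real (w i) * QRe (\<Sum>k\<in>UNIV. (\<Sum>l\<in>UNIV. qcnj (U $ l $ i) * P $ l $ k) * U $ k $ i))"
    by (simp add: f_def fun_eq_iff matrix_matrix_mult_def)
  then have "continuous_on ?K f"
    by (simp only:) (intro continuous_intros)
  moreover have "mat 1 \<in> ?K" by simp
  ultimately obtain U where U: "adj U ** U = mat 1" and max: "\<And>V. adj V ** V = mat 1 \<Longrightarrow> f V \<le> f U"
    using continuous_attains_sup[OF compact_isometries, of f] by blast
  define B where "B = adj U ** P ** U"
  have B: "hermitian B"
    using P by (simp add: B_def hermitian_def adj_mult matrix_mul_assoc)
  have no_rot: "B $ p $ q = 0" if "w q < w p" for p q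
  proof (rule ccontr)
    assume "B $ p $ q \<noteq> 0"
    moreover have "p \<noteq> q" "real (w q) < real (w p)" using that by auto
    ultimately obtain G where G: "adj G ** G = mat 1"
      "(\<Sum>i\<in>UNIV. w i * QRe ((adj G ** B ** G) $ i $ i)) > (\<Sum>i\<in>UNIV. w i * QRe (B $ i $ i))"
      using plane_rotation[OF B, of p q "\<lambda>i. real (w i)"] by blast
    have "adj (U ** G) ** (U ** G) = adj G ** (adj U ** U) ** G"
      by (simp only: adj_mult matrix_mul_assoc)
    then have "f (U ** G) \<le> f U" using U G(1) by (intro max) simp
    moreover have "adj (U ** G) ** P ** (U ** G) = adj G ** B ** G"
      by (simp only: B_def adj_mult matrix_mul_assoc)
    ultimately show False using G(2) by (simp add: f_def B_def)
  qed
  have off: "B $ p $ q = 0" if "p \<noteq> q" for p q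
  proof -
    \<comment> \<open>Distinct weights decide which of the two mirror entries \<open>no_rot\<close>
      kills; the Hermitian symmetry gives the other.\<close>
    have "w p \<noteq> w q" using w that by (simp add: inj_eq)
    then consider "w q < w p" | "w p < w q" by linarith
    then show ?thesis
    proof cases
      case 2
      then show ?thesis using no_rot[OF 2] hermitian_nth[OF B, of q p] by simp
    qed (rule no_rot)
  qed
  have diag: "B $ i $ i = of_real (QRe (B $ i $ i))" for i
    using hermitian_nth[OF B, of i i] qcnj_eq_self_iff by blast
  have Bd: "B = qdiag (\<lambda>i. QRe (B $ i $ i))"
    unfolding vec_eq_iff using off diag by (auto simp: qdiag_def)
  \<comment> \<open>A left inverse makes \<open>U\<close> injective, and a square injective matrix
    has a right inverse, which then equals \<open>adj U\<close>.\<close>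
  obtain V where V: "U ** V = mat 1"
    using injective_imp_inverse[of U]
    by (metis U matrix_vector_mul_assoc matrix_vector_mul_lid matrix_vector_mult_0_right)
  then have UU: "U ** adj U = mat 1" using U matrix_inverse_unique by blast
  have "P = (U ** adj U) ** P ** (U ** adj U)" by (simp add: UU)
  also have "\<dots> = U ** B ** adj U" by (simp only: B_def matrix_mul_assoc)
  finally have "P = U ** qdiag (\<lambda>i. QRe (B $ i $ i)) ** adj U" using Bd by metis
  then show thesis by (rule that[OF U UU])
qed

section \<open>Positive definite square roots\<close>

definition rtrace :: "quat^'n^'n \<Rightarrow> real" where
  "rtrace A = (\<Sum>i\<in>UNIV. QRe (A $ i $ i))"

text \<open>The quaternionic trace itself is not cyclic; its real part is, because real parts of
  products commute.\<close>

lemma rtrace_mult_commute: "rtrace (A ** B) = rtrace (B ** A)"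
proof -
  have "rtrace (A ** B) = (\<Sum>i\<in>UNIV. \<Sum>k\<in>UNIV. QRe (B $ k $ i * A $ i $ k))"
    unfolding rtrace_def matrix_matrix_mult_def vec_lambda_beta QRe_sum
    by (subst QRe_mult_commute) (rule refl)
  also have "\<dots> = rtrace (B ** A)"
    unfolding rtrace_def matrix_matrix_mult_def vec_lambda_beta QRe_sum by (rule sum.swap)
  finally show ?thesis .
qed

lemma pos_def_nonneg: "pos_def P \<Longrightarrow> QRe (hip x (P *v x)) \<ge> 0"
  by (cases "x = 0") (auto simp: pos_def_iff less_imp_le)

text \<open>For \<open>D = Q - R\<close> the hypothesis gives \<open>Q ** D + D ** R = 0\<close>, so
  the real traces of \<open>D ** Q ** D\<close> and \<open>D ** R ** D\<close> are opposite. Both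
  are sums of values of positive forms on the columns of \<open>D\<close>; hence both vanish and so
  does every column.\<close>

lemma pos_def_sqrt_unique:
  assumes "pos_def Q" "pos_def R" "Q ** Q = R ** R"
  shows "Q = R"
proof -
  let ?D = "Q - R"
  have adjD: "adj ?D = ?D" using assms by (simp add: adj_diff pos_def_iff hermitian_def)
  have tr: "rtrace (?D ** Q ** ?D) = - rtrace (?D ** R ** ?D)"
  proof -
    have "?D ** Q ** ?D + ?D ** ?D ** R = ?D ** (Q ** ?D + ?D ** R)"
      by (simp only: matrix_add_ldistrib matrix_mul_assoc)
    also have "Q ** ?D + ?D ** R = 0"
      using assms(3) by (simp add: matrix_mul_diff_left matrix_mul_diff_right)
    finally have "rtrace (?D ** Q ** ?D + ?D ** ?D ** R) = 0" by (simp add: rtrace_def)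
    then have "rtrace (?D ** Q ** ?D) + rtrace (?D ** (?D ** R)) = 0"
      by (simp add: rtrace_def sum.distrib matrix_mul_assoc)
    also have "rtrace (?D ** (?D ** R)) = rtrace (?D ** R ** ?D)" by (rule rtrace_mult_commute)
    finally show ?thesis by simp
  qed
  have form: "rtrace (?D ** S ** ?D) = (\<Sum>i\<in>UNIV. QRe (hip (column i ?D) (S *v column i ?D)))" for S
  proof -
    have "rtrace (?D ** S ** ?D) = rtrace (adj ?D ** S ** ?D)" by (simp only: adjD)
    then show ?thesis by (simp only: rtrace_def adj_mult_mult_nth)
  qed
  have "(\<Sum>i\<in>UNIV. QRe (hip (column i ?D) (R *v column i ?D))) \<ge> 0"
    by (intro sum_nonneg pos_def_nonneg assms)
  moreover have "(\<Sum>i\<in>UNIV. QRe (hip (column i ?D) (Q *v column i ?D))) \<ge> 0"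
    by (intro sum_nonneg pos_def_nonneg assms)
  ultimately have "(\<Sum>i\<in>UNIV. QRe (hip (column i ?D) (Q *v column i ?D))) = 0"
    using tr unfolding form by linarith
  then have "QRe (hip (column i ?D) (Q *v column i ?D)) = 0" for i
    by (subst (asm) sum_nonneg_eq_0_iff) (auto intro: pos_def_nonneg assms)
  then have "column i ?D = 0" for i using assms(1) unfolding pos_def_iff by (metis less_irrefl)
  then have "?D = 0" by (rule columns_0_imp)
  then show ?thesis by simp
qed

lemma pos_def_sqrt_exists:
  fixes P :: "quat^'n^'n"
  assumes "pos_def P"
  shows "\<exists>Q. pos_def Q \<and> Q ** Q = P"
proof -
  have "hermitian P" using assms by (simp add: pos_def_iff)
  then obtain U :: "quat^'n^'n" and d where U: "adj U ** U = mat 1" "U ** adj U = mat 1" and P: "P = U ** qdiag d ** adj U"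
    by (rule hermitian_diagonalization)
  \<comment> \<open>The eigenvalue \<open>d i\<close> is the value of the form of \<open>P\<close>
    at the nonzero column \<open>i\<close> of \<open>U\<close>.\<close>
  have d: "d i > 0" for i
  proof -
    have "column i U \<noteq> 0"
    proof
      assume "column i U = 0"
      then have "(adj U ** U) $ i $ i = 0" by (simp add: adj_mult_nth)
      then show False by (simp add: U mat_def)
    qed
    then have "QRe (hip (column i U) (P *v column i U)) > 0" using assms by (simp add: pos_def_iff)
    also have "hip (column i U) (P *v column i U) = (adj U ** P ** U) $ i $ i"
      by (simp only: adj_mult_mult_nth)
    also have "adj U ** P ** U = (adj U ** U) ** qdiag d ** (adj U ** U)"
      by (simp only: P matrix_mul_assoc)
    also have "\<dots> = qdiag d" by (simp add: U)
    finally show ?thesis by (simp add: qdiag_def)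
  qed
  define Q where "Q = U ** qdiag (\<lambda>i. sqrt (d i)) ** adj U"
  have "Q ** Q = U ** qdiag (\<lambda>i. sqrt (d i)) ** (adj U ** U) ** qdiag (\<lambda>i. sqrt (d i)) ** adj U"
    by (simp only: Q_def matrix_mul_assoc)
  also have "\<dots> = U ** (qdiag (\<lambda>i. sqrt (d i)) ** qdiag (\<lambda>i. sqrt (d i))) ** adj U"
    by (simp add: U matrix_mul_assoc)
  also have "\<dots> = P" using d by (simp add: P qdiag_mult less_imp_le)
  finally have "Q ** Q = P" .
  moreover have "pos_def Q"
    unfolding pos_def_iff
  proof (intro conjI allI impI)
    show "hermitian Q" by (simp add: Q_def hermitian_def adj_mult matrix_mul_assoc)
    fix x :: "quat^'n" assume "x \<noteq> 0"
    let ?y = "adj U *v x"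
    have "U *v ?y = x" by (simp add: matrix_vector_mul_assoc U)
    then have "?y \<noteq> 0" using \<open>x \<noteq> 0\<close> by auto
    then obtain i where i: "?y $ i \<noteq> 0" by (auto simp: vec_eq_iff)
    have "Q *v x = U *v (qdiag (\<lambda>i. sqrt (d i)) *v ?y)"
      by (simp only: Q_def matrix_vector_mul_assoc matrix_mul_assoc)
    then have "hip x (Q *v x) = hip ?y (qdiag (\<lambda>i. sqrt (d i)) *v ?y)"
      by (simp only: hip_mult_vec[of x U])
    then have "QRe (hip x (Q *v x)) = (\<Sum>i\<in>UNIV. sqrt (d i) * qnorm2 (?y $ i))"
      by (simp only: hip_qdiag)
    also have "\<dots> > 0"
    proof (rule sum_pos2[of _ i])
      have "qnorm2 (?y $ i) > 0" using i qnorm2_nonneg[of "?y $ i"] by (simp add: less_le)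
      then show "0 < sqrt (d i) * qnorm2 (?y $ i)" using d[of i] by simp
      show "0 \<le> sqrt (d j) * qnorm2 (?y $ j)" for j using d[of j] by simp
    qed auto
    finally show "QRe (hip x (Q *v x)) > 0" .
  qed
  ultimately show ?thesis by blast
qed

lemma mat_sqrt:
  assumes "pos_def P"
  shows "pos_def (mat_sqrt P)" "mat_sqrt P ** mat_sqrt P = P"
proof -
  have "\<exists>!Q. pos_def Q \<and> Q ** Q = P"
    using pos_def_sqrt_exists[OF assms] pos_def_sqrt_unique by metis
  then have "pos_def (mat_sqrt P) \<and> mat_sqrt P ** mat_sqrt P = P"
    unfolding mat_sqrt_def by (rule theI')
  then show "pos_def (mat_sqrt P)" "mat_sqrt P ** mat_sqrt P = P" by blast+
qed

text \<open>Inverting the eigenvalues works even for singular \<open>B\<close>: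
  \<open>inverse 0 = 0\<close> for reals leaves the kernel untouched.\<close>

lemma hermitian_pseudoinverse:
  fixes B :: "quat^'n^'n"
  assumes "hermitian B"
  obtains G :: "quat^'n^'n" where "hermitian G" "G ** B = B ** G" "B ** G ** B = B" "G ** B ** G = G"
proof -
  obtain U :: "quat^'n^'n" and d where U: "adj U ** U = mat 1" "U ** adj U = mat 1" and B: "B = U ** qdiag d ** adj U"
    using assms by (rule hermitian_diagonalization)
  define G where "G = U ** qdiag (\<lambda>i. inverse (d i)) ** adj U"
  have mult: "(U ** qdiag a ** adj U) ** (U ** qdiag b ** adj U) = U ** qdiag (\<lambda>i. a i * b i) ** adj U" for a b
  proof -
    have "(U ** qdiag a ** adj U) ** (U ** qdiag b ** adj U) = U ** qdiag a ** (adj U ** U) ** qdiag b ** adj U"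
      by (simp only: matrix_mul_assoc)
    also have "\<dots> = U ** (qdiag a ** qdiag b) ** adj U" by (simp add: U matrix_mul_assoc)
    finally show ?thesis by (simp only: qdiag_mult)
  qed
  have inv: "x * inverse x * x = x" for x :: real by (cases "x = 0") auto
  show thesis
  proof (rule that[of G])
    show "hermitian G" by (simp add: G_def hermitian_def adj_mult matrix_mul_assoc)
    show "G ** B = B ** G" unfolding G_def B mult by (simp only: mult.commute)
    show "B ** G ** B = B" unfolding G_def B mult inv ..
    have "inverse x * x * inverse x = inverse x" for x :: real by (cases "x = 0") auto
    then show "G ** B ** G = G" unfolding G_def B mult by (simp only:)
  qed
qed

section \<open>Weighted Moore-Penrose inverses: uniqueness and adjoints\<close>

definition is_wmp :: "quat^'m^'m \<Rightarrow> quat^'n^'n \<Rightarrow> quat^'n^'m \<Rightarrow> quat^'m^'n \<Rightarrow> bool" where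
  "is_wmp M N A X \<longleftrightarrow> A ** X ** A = A \<and> X ** A ** X = X \<and>
     adj (M ** A ** X) = M ** A ** X \<and> adj (N ** X ** A) = N ** X ** A"

text \<open>This is Penrose's argument with weights. Inserting \<open>A ** Y ** A = A\<close> writes
  \<open>M ** A ** X\<close> as a product of two Hermitian matrices around \<open>M'\<close>; taking
  adjoints exchanges them and yields \<open>A ** X = A ** Y\<close>. The weight \<open>N\<close>
  gives \<open>Y ** A = X ** A\<close> in the same way, and \<open>X = X ** A ** X\<close> can be
  rewritten to \<open>Y\<close>.\<close>

lemma is_wmp_unique:
  assumes "pos_def M" "pos_def N" "is_wmp M N A X" "is_wmp M N A Y"
  shows "X = Y"
proof -
  obtain M' where M': "M ** M' = mat 1" "M' ** M = mat 1" using pos_def_inverse[OF assms(1)] by blast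
  obtain N' where N': "N ** N' = mat 1" "N' ** N = mat 1" using pos_def_inverse[OF assms(2)] by blast
  have adjM: "adj M' = M'" using hermitian_inverse[OF _ M'] assms(1) by (simp add: pos_def_iff hermitian_def)
  have adjN: "adj N' = N'" using hermitian_inverse[OF _ N'] assms(2) by (simp add: pos_def_iff hermitian_def)
  have X: "A ** X ** A = A" "X ** A ** X = X" "adj (M ** A ** X) = M ** A ** X" "adj (N ** X ** A) = N ** X ** A"
    using assms(3) by (auto simp: is_wmp_def)
  have Y: "A ** Y ** A = A" "Y ** A ** Y = Y" "adj (M ** A ** Y) = M ** A ** Y" "adj (N ** Y ** A) = N ** Y ** A"
    using assms(4) by (auto simp: is_wmp_def)
  have "M ** A ** X = M ** (A ** Y ** A) ** X" by (simp only: Y)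
  also have "\<dots> = (M ** A ** Y) ** (M' ** M) ** A ** X" by (simp add: M' matrix_mul_assoc)
  also have "\<dots> = (M ** A ** Y) ** M' ** (M ** A ** X)" by (simp only: matrix_mul_assoc)
  finally have "adj (M ** A ** X) = adj ((M ** A ** Y) ** M' ** (M ** A ** X))" by (rule arg_cong)
  then have "M ** A ** X = (M ** A ** X) ** (M' ** (M ** A ** Y))"
    by (simp only: adj_mult[of "(M ** A ** Y) ** M'"] adj_mult[of "M ** A ** Y"] X Y adjM)
  also have "\<dots> = M ** A ** X ** (M' ** M) ** A ** Y" by (simp only: matrix_mul_assoc)
  also have "\<dots> = M ** (A ** X ** A) ** Y" by (simp add: M' matrix_mul_assoc)
  also have "\<dots> = M ** A ** Y" by (simp only: X)
  finally have "M' ** M ** A ** X = M' ** M ** A ** Y" by (metis matrix_mul_assoc)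
  then have AX: "A ** X = A ** Y" by (simp add: M')
  have "N ** Y ** A = N ** Y ** (A ** X ** A)" by (simp only: X)
  also have "\<dots> = (N ** Y ** A) ** (N' ** N) ** X ** A" by (simp add: N' matrix_mul_assoc)
  also have "\<dots> = (N ** Y ** A) ** N' ** (N ** X ** A)" by (simp only: matrix_mul_assoc)
  finally have "adj (N ** Y ** A) = adj ((N ** Y ** A) ** N' ** (N ** X ** A))" by (rule arg_cong)
  then have "N ** Y ** A = (N ** X ** A) ** (N' ** (N ** Y ** A))"
    by (simp only: adj_mult[of "(N ** Y ** A) ** N'"] adj_mult[of "N ** Y ** A"] X Y adjN)
  also have "\<dots> = N ** X ** A ** (N' ** N) ** Y ** A" by (simp only: matrix_mul_assoc)
  also have "\<dots> = N ** X ** (A ** Y ** A)" by (simp add: N' matrix_mul_assoc)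
  also have "\<dots> = N ** X ** A" by (simp only: Y)
  finally have "N' ** N ** Y ** A = N' ** N ** X ** A" by (metis matrix_mul_assoc)
  then have XA: "Y ** A = X ** A" by (simp add: N')
  have "X = X ** (A ** X)" using X(2) by (simp only: matrix_mul_assoc)
  also have "\<dots> = X ** A ** Y" by (simp only: AX matrix_mul_assoc)
  also have "\<dots> = Y" by (simp only: XA[symmetric] Y)
  finally show ?thesis .
qed

lemma wmp_inverse_eqI:
  assumes "pos_def M" "pos_def N" "is_wmp M N A X"
  shows "wmp_inverse M N A = X"
proof -
  have "wmp_inverse M N A = (THE X. is_wmp M N A X)" by (simp only: wmp_inverse_def is_wmp_def)
  also have "\<dots> = X" using assms is_wmp_unique by (intro the_equality) blast+
  finally show ?thesis .
qed

text \<open>For Hermitian \<open>P\<close>, the matrix \<open>P ** H\<close> is Hermitian iff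
  \<open>adj H ** P = P ** H\<close>. Multiplying by the inverse of \<open>P\<close> on both sides
  turns this into the symmetry condition for the adjoint with the inverse weight, and the two
  weights change places.\<close>

lemma is_wmp_adj:
  assumes "pos_def M" "pos_def N" "is_wmp M N A X"
  shows "is_wmp (matrix_inv N) (matrix_inv M) (adj A) (adj X)"
proof -
  obtain M' where M': "M ** M' = mat 1" "M' ** M = mat 1" "matrix_inv M = M'" using pos_def_inverse[OF assms(1)] by blast
  obtain N' where N': "N ** N' = mat 1" "N' ** N = mat 1" "matrix_inv N = N'" using pos_def_inverse[OF assms(2)] by blast
  have adjM: "adj M' = M'" "adj M = M"
    using hermitian_inverse[OF _ M'(1,2)] assms(1) by (simp_all add: pos_def_iff hermitian_def)
  have adjN: "adj N' = N'" "adj N = N"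
    using hermitian_inverse[OF _ N'(1,2)] assms(2) by (simp_all add: pos_def_iff hermitian_def)
  have X: "A ** X ** A = A" "X ** A ** X = X" "adj (M ** A ** X) = M ** A ** X" "adj (N ** X ** A) = N ** X ** A"
    using assms(3) by (auto simp: is_wmp_def)
  have conj: "P' ** adj H = H ** P'"
    if "P ** P' = mat 1" "P' ** P = mat 1" "adj P = P" "adj (P ** H) = P ** H" for P P' H :: "quat^'k^'k"
  proof -
    have "adj H ** P = P ** H" using that by (simp add: adj_mult)
    then have "P' ** (adj H ** P) ** P' = P' ** (P ** H) ** P'" by simp
    then have "P' ** adj H ** (P ** P') = (P' ** P) ** H ** P'" by (simp only: matrix_mul_assoc)
    then show ?thesis using that by simp
  qed
  show ?thesis
    unfolding is_wmp_def M'(3) N'(3)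
  proof (intro conjI)
    have "adj (A ** X ** A) = adj A" by (simp only: X)
    then show "adj A ** adj X ** adj A = adj A" by (simp only: adj_mult matrix_mul_assoc)
    have "adj (X ** A ** X) = adj X" by (simp only: X)
    then show "adj X ** adj A ** adj X = adj X" by (simp only: adj_mult matrix_mul_assoc)
    have "N' ** adj (X ** A) = (X ** A) ** N'"
      using N' adjN X(4) by (intro conj[of N]) (simp_all add: matrix_mul_assoc)
    then show "adj (N' ** adj A ** adj X) = N' ** adj A ** adj X"
      by (simp add: adj_mult adjN matrix_mul_assoc)
    have "M' ** adj (A ** X) = (A ** X) ** M'"
      using M' adjM X(3) by (intro conj[of M]) (simp_all add: matrix_mul_assoc)
    then show "adj (M' ** adj X ** adj A) = M' ** adj X ** adj A"
      by (simp add: adj_mult adjM matrix_mul_assoc)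
  qed
qed

section \<open>Determinantal representation\<close>

lemma support_inv:
  assumes "permutation \<sigma>"
  shows "support (inv \<sigma>) s = map \<sigma> (rev (support \<sigma> s))"
proof -
  have bij: "bij \<sigma>" using assms permutation_bijective by blast
  have funpow: "(inv \<sigma> ^^ n) x = y \<longleftrightarrow> (\<sigma> ^^ n) y = x" for n x y
    using bij_inv_eq_iff[OF bij_fn[OF bij]] by (metis inv_fn[OF bij])
  have lp: "least_power (inv \<sigma>) s = least_power \<sigma> s"
    unfolding least_power_def funpow ..
  let ?m = "least_power \<sigma> s"
  show ?thesis
  proof (rule nth_equalityI)
    show "length (support (inv \<sigma>) s) = length (map \<sigma> (rev (support \<sigma> s)))" by (simp add: lp)
    fix i assume "i < length (support (inv \<sigma>) s)"
    then have i: "i < ?m" by (simp add: lp)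
    have "map \<sigma> (rev (support \<sigma> s)) ! i = \<sigma> ((\<sigma> ^^ (?m - Suc i)) s)"
      using i by (simp add: rev_nth)
    also have "\<dots> = (\<sigma> ^^ (?m - i)) s"
      using i by (metis Suc_diff_Suc funpow.simps(2) o_apply)
    finally have nth: "map \<sigma> (rev (support \<sigma> s)) ! i = (\<sigma> ^^ (?m - i)) s" .
    have "(\<sigma> ^^ i) ((\<sigma> ^^ (?m - i)) s) = (\<sigma> ^^ (i + (?m - i))) s"
      by (simp add: funpow_add)
    also have "i + (?m - i) = ?m" using i by simp
    also have "(\<sigma> ^^ ?m) s = s" by (rule least_power_of_permutation(1)[OF assms])
    finally have "(inv \<sigma> ^^ i) s = (\<sigma> ^^ (?m - i)) s" by (simp only: funpow)
    then show "support (inv \<sigma>) s ! i = map \<sigma> (rev (support \<sigma> s)) ! i"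
      unfolding nth using i by (simp add: lp)
  qed
qed

lemma set_support_inv:
  assumes "permutation \<sigma>"
  shows "set (support (inv \<sigma>) s) = set (support \<sigma> s)"
proof -
  have "\<sigma> ` set (support \<sigma> s) \<subseteq> set (support \<sigma> s)"
  proof (rule image_subsetI)
    fix x assume "x \<in> set (support \<sigma> s)"
    then obtain i where "x = (\<sigma> ^^ i) s" unfolding support_set[OF assms] by blast
    then have "\<sigma> x = (\<sigma> ^^ Suc i) s" by simp
    then show "\<sigma> x \<in> set (support \<sigma> s)" unfolding support_set[OF assms] by blast
  qed
  moreover have "inj_on \<sigma> (set (support \<sigma> s))"
    using permutation_bijective[OF assms] bij_is_inj inj_on_subset by blast
  ultimately have "\<sigma> ` set (support \<sigma> s) = set (support \<sigma> s)"
    by (intro endo_inj_surj) auto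
  then show ?thesis unfolding support_inv[OF assms] set_map set_rev .
qed

lemma qcnj_prod_list: "qcnj (prod_list xs) = prod_list (rev (map qcnj xs))"
  by (induction xs) auto

lemma rev_map_concat: "rev (map f (concat (map g xs))) = concat (map (\<lambda>x. rev (map f (g x))) (rev xs))"
  by (induction xs) auto

text \<open>Conjugation reverses products, so it turns the arrangement of cycles of \<open>\<sigma>\<close> in a row
  determinant into the arrangement of cycles of \<open>\<sigma>\<inverse>\<close> in a column determinant.\<close>

lemma qcnj_rdet:
  fixes B :: "quat^'n::{finite,linorder}^'n::{finite,linorder}"
  shows "qcnj (rdet S i B) = cdet S i (adj B)"
proof -
  have summand: "qcnj ((-1) ^ (card S - card (cycle_sets S \<sigma>)) *
      prod_list (concat (map (cycle_factors B \<sigma>) (i # other_starts S i \<sigma>)))) =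
    (-1) ^ (card S - card (cycle_sets S (inv \<sigma>))) *
      prod_list (concat (map (cycle_factors (adj B) (inv \<sigma>)) (rev (other_starts S i (inv \<sigma>)) @ [i])))"
    if \<sigma>: "\<sigma> permutes S" for \<sigma>
  proof -
    have perm: "permutation \<sigma>" using \<sigma> by (rule permutation_of_permutes)
    have cs: "cycle_sets S (inv \<sigma>) = cycle_sets S \<sigma>"
      unfolding cycle_sets_def set_support_inv[OF perm] ..
    have os: "other_starts S i (inv \<sigma>) = other_starts S i \<sigma>"
      unfolding other_starts_def cs ..
    have cf: "rev (map qcnj (cycle_factors B \<sigma> s)) = cycle_factors (adj B) (inv \<sigma>) s" for s
    proof -
      \<comment> \<open>The cycle of the inverse is listed through the points
        \<open>\<sigma> x\<close>, where \<open>adj B\<close> contributes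
        \<open>adj B $ \<sigma> x $ x\<close>, the conjugate of
        \<open>B $ x $ \<sigma> x\<close>.\<close>
      have "inv \<sigma> (\<sigma> x) = x" for x by (rule permutes_inverses(2)[OF \<sigma>])
      then show ?thesis
        unfolding cycle_factors_def support_inv[OF perm] by (simp only: rev_map map_map o_def adj_nth)
    qed
    have "qcnj (prod_list (concat (map (cycle_factors B \<sigma>) (i # other_starts S i \<sigma>)))) =
      prod_list (concat (map (cycle_factors (adj B) (inv \<sigma>)) (rev (other_starts S i \<sigma>) @ [i])))"
      unfolding qcnj_prod_list rev_map_concat cf rev.simps ..
    moreover have "x * (-1) ^ n = (-1) ^ n * x" for x :: quat and n by (simp add: minus_one_power_iff)
    ultimately show ?thesis
      unfolding cs os by (simp only: qcnj_simps qcnj_power)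
  qed
  have "qcnj (rdet S i B) = (\<Sum>\<sigma> | \<sigma> permutes S. (-1) ^ (card S - card (cycle_sets S (inv \<sigma>))) *
      prod_list (concat (map (cycle_factors (adj B) (inv \<sigma>)) (rev (other_starts S i (inv \<sigma>)) @ [i]))))"
    unfolding rdet_def qcnj_sum by (intro sum.cong refl summand) simp
  also have "\<dots> = cdet S i (adj B)"
    unfolding cdet_def by (rule sum_permutations_inverse[symmetric])
  finally show ?thesis .
qed

lemma rdet_repl_row:
  "rdet S l (repl_row l c B) = qcnj (cdet S l (repl_col l (\<chi> j. qcnj (c $ j)) (adj B)))"
proof -
  have "adj (repl_row l c B) = repl_col l (\<chi> j. qcnj (c $ j)) (adj B)"
    by (simp add: vec_eq_iff repl_row_def repl_col_def)
  then show ?thesis by (metis qcnj_rdet qcnj_simps(7))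
qed

text \<open>The column determinants share a real value; conjugation carries it over to the row
  determinants, and a nonempty \<open>S\<close> makes the real number described by
  \<open>hdet\<close> unique.\<close>

lemma of_real_hdet:
  fixes B :: "quat^'n::{finite,linorder}^'n::{finite,linorder}"
  assumes "hermitian B" "S \<noteq> {}"
  shows "of_real (hdet S B) = pdet S B"
proof -
  define d where "d = QRe (pdet S B)"
  have d: "pdet S B = of_real d" unfolding d_def by (rule hermitian_cdet(1)[OF assms(1)])
  have c: "cdet S i B = of_real d" if "i \<in> S" for i
    using hermitian_cdet(2)[OF assms(1) that] d by simp
  have r: "rdet S i B = of_real d" if "i \<in> S" for i
  proof -
    have "qcnj (rdet S i B) = of_real d" using c[OF that] assms(1) by (simp add: qcnj_rdet hermitian_def)
    then show ?thesis by (metis qcnj_of_real qcnj_simps(7))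
  qed
  have "hdet S B = d"
    unfolding hdet_def
  proof (rule the_equality)
    show "\<forall>i\<in>S. rdet S i B = of_real d \<and> cdet S i B = of_real d" using c r by blast
    fix e assume "\<forall>i\<in>S. rdet S i B = of_real e \<and> cdet S i B = of_real e"
    with assms(2) c have "(of_real e :: quat) = of_real d" by (metis ex_in_conv)
    then show "e = d" by (metis QRe_of_real)
  qed
  with d show ?thesis by simp
qed

section \<open>Cramer's rule and the minors of Gram matrices\<close>

lemma cdet_repl_col_cong:
  fixes B :: "quat^'n::{finite,linorder}^'n::{finite,linorder}"
  assumes "k \<in> S" "\<And>i. i \<in> S \<Longrightarrow> v $ i = v' $ i"
  shows "cdet S k (repl_col k v B) = cdet S k (repl_col k v' B)"
  unfolding cdet_repl_col_axis_sum[OF assms(1), of v] cdet_repl_col_axis_sum[OF assms(1), of v']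
proof (intro sum.cong refl)
  show "cdet S k (repl_col k (axis s 1) B) * v $ s = cdet S k (repl_col k (axis s 1) B) * v' $ s" for s
    using assms cdet_repl_col_axis_notin[of k S s B] by (cases "s \<in> S") auto
qed

text \<open>Expanding \<open>B *v x\<close> by columns, indices outside \<open>S\<close> drop out
  because \<open>x\<close> vanishes there, and indices of \<open>S\<close> other than
  \<open>k\<close> give two equal columns.\<close>

lemma cramer:
  fixes B :: "quat^'n::{finite,linorder}^'n::{finite,linorder}"
  assumes "hermitian B" "k \<in> S" "\<And>i. i \<notin> S \<Longrightarrow> x $ i = 0"
  shows "cdet S k (repl_col k (B *v x) B) = pdet S B * x $ k"
proof -
  have "cdet S k (repl_col k (B *v x) B) = (\<Sum>s\<in>UNIV. if s = k then pdet S B * x $ s else 0)"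
    unfolding cdet_repl_col_mult_vec[OF assms(2)]
  proof (intro sum.cong refl)
    fix s
    show "cdet S k (repl_col k (column s B) B) * x $ s = (if s = k then pdet S B * x $ s else 0)"
    proof (cases "s = k")
      case True
      then show ?thesis using hermitian_cdet(2)[OF assms(1,2)] by simp
    next
      case False
      then show ?thesis using assms(3) cdet_repl_col_other[OF assms(1,2), of s] by (cases "s \<in> S") auto
    qed
  qed
  then show ?thesis by simp
qed

lemma right_indep_cols_subset:
  "right_indep_cols A T \<Longrightarrow> S \<subseteq> T \<Longrightarrow> right_indep_cols A S"
  unfolding right_indep_cols_iff by blast

lemma hip_gram: "hip x ((adj C ** C) *v x) = hip (C *v x) (C *v x)"
  by (simp add: hip_mult_vec flip: matrix_vector_mul_assoc)

text \<open>Induction on the size of \<open>S\<close>. If \<open>x\<close> is supported on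
  \<open>S\<close> and solves \<open>?B *v x = axis k 1\<close> there, Cramer's rule says that the
  minor of \<open>S - {k}\<close> is the minor of \<open>S\<close> times \<open>x $ k\<close>, and
  \<open>QRe (x $ k)\<close> is the squared norm of \<open>C *v x\<close>, which is
  positive.\<close>

lemma gram_minor_pos:
  fixes C :: "quat^'n::{finite,linorder}^'m"
  assumes "right_indep_cols C S"
  shows "QRe (pdet S (adj C ** C)) > 0"
  using assms
proof (induction "card S" arbitrary: S)
  case 0
  then have "S = {}" by simp
  then show ?case by simp
next
  case (Suc n)
  let ?B = "adj C ** C"
  have B: "hermitian ?B" by (rule hermitian_adj_mult_self)
  obtain k where k: "k \<in> S" using Suc by fastforce
  have smaller: "QRe (pdet (S - {k}) ?B) > 0"
    using Suc k by (intro Suc(1) right_indep_cols_subset[OF Suc(3)]) auto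
  have "\<exists>x. (\<forall>i. i \<notin> S \<longrightarrow> x $ i = 0) \<and> (\<forall>i\<in>S. (?B *v x) $ i = axis k 1 $ i)"
  proof (rule solve_on_indices[of S ?B "axis k 1"])
    fix x assume x: "\<And>i. i \<notin> S \<Longrightarrow> x $ i = 0" "\<And>i. i \<in> S \<Longrightarrow> (?B *v x) $ i = 0"
    have "hip x (?B *v x) = 0"
      unfolding hip_def
    proof (intro sum.neutral ballI)
      show "qcnj (x $ i) * (?B *v x) $ i = 0" for i using x by (cases "i \<in> S") auto
    qed
    then have "C *v x = 0" unfolding hip_gram by (simp only: hip_self_eq_0_iff)
    then show "x = 0" using Suc(3) x(1) unfolding right_indep_cols_iff by blast
  next
    fix x assume "\<And>i. i \<notin> S \<Longrightarrow> x $ i = 0" "\<And>i. i \<in> S \<Longrightarrow> (?B *v x) $ i = axis k 1 $ i"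
    then show "\<exists>x. (\<forall>i. i \<notin> S \<longrightarrow> x $ i = 0) \<and> (\<forall>i\<in>S. (?B *v x) $ i = axis k 1 $ i)" by blast
  qed
  then obtain x where x: "\<And>i. i \<notin> S \<Longrightarrow> x $ i = 0" "\<And>i. i \<in> S \<Longrightarrow> (?B *v x) $ i = axis k 1 $ i"
    by blast
  have "pdet (S - {k}) ?B = pdet S ?B * x $ k"
    using cramer[OF B k x(1)] cdet_repl_col_cong[OF k x(2), of ?B] cdet_repl_col_axis_same[OF k, of ?B] by simp
  then have "QRe (pdet (S - {k}) ?B) = QRe (of_real (QRe (pdet S ?B)) * x $ k)"
    using hermitian_cdet(1)[OF B, of S] by metis
  then have "QRe (pdet (S - {k}) ?B) = QRe (pdet S ?B) * QRe (x $ k)"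
    by (simp only: QRe_of_real_mult)
  moreover have "QRe (x $ k) > 0"
  proof -
    have "(?B *v x) $ k = 1" using x(2)[OF k] by (simp add: axis_def)
    then have "C *v x \<noteq> 0" by (auto simp flip: matrix_vector_mul_assoc)
    then have "QRe (hip x (?B *v x)) > 0" unfolding hip_gram by (rule hip_self_pos)
    also have "hip x (?B *v x) = hip x (axis k 1)"
      unfolding hip_def
    proof (intro sum.cong refl)
      show "qcnj (x $ i) * (?B *v x) $ i = qcnj (x $ i) * axis k 1 $ i" for i
        using x by (cases "i \<in> S") auto
    qed
    finally show ?thesis by (simp add: hip_axis)
  qed
  ultimately show ?case using smaller by (simp add: zero_less_mult_iff)
qed

text \<open>A dependency \<open>x\<close> supported on \<open>S\<close> satisfies
  \<open>?B *v x = 0\<close>, so Cramer's rule makes the minor times a nonzero \<open>x $ k\<close>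
  vanish.\<close>

lemma gram_minor_zero:
  fixes C :: "quat^'n::{finite,linorder}^'m"
  assumes "\<not> right_indep_cols C S"
  shows "pdet S (adj C ** C) = 0"
proof -
  let ?B = "adj C ** C"
  obtain x where x: "\<And>i. i \<notin> S \<Longrightarrow> x $ i = 0" "C *v x = 0" "x \<noteq> 0"
    using assms unfolding right_indep_cols_iff by blast
  then obtain k where k: "x $ k \<noteq> 0" by (auto simp: vec_eq_iff)
  then have kS: "k \<in> S" using x(1) by blast
  have "?B *v x = 0" by (simp add: x(2) flip: matrix_vector_mul_assoc)
  then have "pdet S ?B * x $ k = cdet S k (repl_col k 0 ?B)"
    using cramer[OF hermitian_adj_mult_self kS x(1), of C] by simp
  also have "\<dots> = 0" unfolding cdet_repl_col_axis_sum[OF kS, of 0] by simp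
  finally show ?thesis using k by simp
qed

lemma gram_minor_sum_pos:
  fixes C :: "quat^'n::{finite,linorder}^'m"
  shows "QRe (minor_sum (qrank C) (adj C ** C)) > 0"
proof -
  obtain S where S: "right_indep_cols C S" "card S = qrank C" by (rule qrank_witness)
  have nonneg: "QRe (pdet T (adj C ** C)) \<ge> 0" for T
    using gram_minor_pos[of C T] gram_minor_zero[of C T] by (cases "right_indep_cols C T") auto
  show ?thesis
    unfolding minor_sum_def QRe_sum using S nonneg
    by (intro sum_pos2[of _ S]) (auto simp: idx_sets_def gram_minor_pos)
qed

lemma gram_minor_sum_zero:
  fixes C :: "quat^'n::{finite,linorder}^'m"
  assumes "s > qrank C"
  shows "minor_sum s (adj C ** C) = 0"
  unfolding minor_sum_def
proof (intro sum.neutral ballI gram_minor_zero notI)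
  fix S assume "S \<in> idx_sets s" "right_indep_cols C S"
  then show False using card_le_qrank[of C S] assms by (simp add: idx_sets_def)
qed

lemma repl_minor_sum_eq_0_of_card:
  fixes B :: "quat^'n::{finite,linorder}^'n::{finite,linorder}"
  assumes "s > CARD('n)"
  shows "repl_minor_sum s k v B = 0"
proof -
  have "card \<beta> \<noteq> s" for \<beta> :: "'n set" using assms card_mono[of UNIV \<beta>] by auto
  then have "idx_sets_with s k = {}" by (auto simp: mem_idx_sets_with)
  then show ?thesis by (simp add: repl_minor_sum_def)
qed

text \<open>Being fixed by the idempotent \<open>B ** G\<close> is the form in which membership in
  the range passes through the downward induction: if \<open>y\<close> is fixed, then
  \<open>y = B *v (G *v y)\<close> and \<open>G *v y\<close> is fixed too.\<close>

lemma repl_minor_sum_range: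
  fixes C :: "quat^'n::{finite,linorder}^'m"
  defines "B \<equiv> adj C ** C"
  assumes G: "G ** B = B ** G" "G ** B ** G = G" and x: "(B ** G) *v x = x"
  shows "repl_minor_sum (qrank C) k (B *v x) B = minor_sum (qrank C) B * x $ k"
proof -
  have B: "hermitian B" unfolding B_def by (rule hermitian_adj_mult_self)
  have "repl_minor_sum s k y B = 0" if "qrank C < s" "(B ** G) *v y = y" for s y
    using that
  \<comment> \<open>The base case is \<open>s > CARD('n)\<close>, where there are no index sets of
    size \<open>s\<close>.\<close>
  proof (induction "CARD('n) + 1 - s" arbitrary: s y)
    case 0
    then show ?case by (intro repl_minor_sum_eq_0_of_card) simp
  next
    case (Suc d)
    let ?z = "G *v y"
    have "(B ** G) *v ?z = ((G ** B) ** G) *v y" by (simp only: G(1) matrix_vector_mul_assoc)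
    then have "repl_minor_sum (Suc s) k ?z B = 0" using Suc by (intro Suc(1)) (simp_all add: G(2))
    moreover have "B *v ?z = y" using Suc(4) by (simp add: matrix_vector_mul_assoc)
    moreover have "minor_sum s B = 0" unfolding B_def by (rule gram_minor_sum_zero[OF Suc(3)])
    ultimately show ?case using repl_minor_sum_recursion[OF B, of s k ?z] by simp
  qed
  then have "repl_minor_sum (Suc (qrank C)) k x B = 0" using x by simp
  then show ?thesis using repl_minor_sum_recursion[OF B, of "qrank C" k x] by simp
qed

lemma minor_sum_conv_hdet:
  fixes B :: "quat^'n::{finite,linorder}^'n::{finite,linorder}"
  assumes "hermitian B" "r \<ge> 1"
  shows "minor_sum r B = of_real (\<Sum>\<beta>\<in>idx_sets r. hdet \<beta> B)"
  unfolding minor_sum_def of_real_sum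
proof (intro sum.cong refl of_real_hdet[OF assms(1), symmetric])
  fix \<beta> :: "'n set" assume "\<beta> \<in> idx_sets r"
  then show "\<beta> \<noteq> {}" using assms(2) by (auto simp: idx_sets_def)
qed

section \<open>Construction of the weighted inverse and the determinantal formulas\<close>

lemma solve_of_real_mult:
  fixes x y :: quat
  assumes "y = of_real d * x" "d \<noteq> 0"
  shows "x = y /\<^sub>R d"
  using assms by (simp add: of_real_def)

text \<open>Since \<open>G\<close> is the pseudoinverse of \<open>adj C ** C\<close>, the matrix
  \<open>G ** adj C\<close> is the ordinary Moore-Penrose inverse of \<open>C\<close>. Undoing the
  substitution \<open>A = m' ** C ** n'\<close> turns it into the weighted inverse \<open>X\<close>
  of \<open>A\<close>.\<close>

lemma wmp_construction:
  fixes A :: "quat^'n^'m"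
  assumes M: "pos_def M" and N: "pos_def N"
  defines "n \<equiv> mat_sqrt (matrix_inv N)" and "m \<equiv> mat_sqrt M"
  defines "C \<equiv> m ** A ** n"
  obtains G X n' where "G ** (adj C ** C) = (adj C ** C) ** G" "G ** (adj C ** C) ** G = G"
    "is_wmp M N A X" "n ** n' = mat 1" "n' ** n = mat 1" "((adj C ** C) ** G) ** (n' ** X) = n' ** X"
    "adj C ** C = n ** adj A ** M ** A ** n"
proof -
  note Ninv = pos_def_matrix_inv[OF N]
  have n: "pos_def n" "n ** n = matrix_inv N" unfolding n_def using mat_sqrt[OF Ninv(1)] by blast+
  have m: "pos_def m" "m ** m = M" unfolding m_def using mat_sqrt[OF M] by blast+
  obtain n' where n': "n ** n' = mat 1" "n' ** n = mat 1" using pos_def_inverse[OF n(1)] by blast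
  obtain m' where m': "m ** m' = mat 1" "m' ** m = mat 1" using pos_def_inverse[OF m(1)] by blast
  have herm: "adj n = n" "adj m = m" using n(1) m(1) by (simp_all add: pos_def_iff hermitian_def)
  have herm': "adj n' = n'" using hermitian_inverse[OF _ n'] n(1) by (simp add: pos_def_iff hermitian_def)
  have N_eq: "N = n' ** n'"
  proof -
    have "(n ** n) ** (n' ** n') = n ** (n ** n') ** n'" by (simp only: matrix_mul_assoc)
    then have "matrix_inv N ** (n' ** n') = mat 1" using n' n(2) by simp
    then show ?thesis using pos_def_inverse(1)[OF N] matrix_inverse_unique by metis
  qed
  define B where "B = adj C ** C"
  have B: "hermitian B" unfolding B_def by (rule hermitian_adj_mult_self)
  obtain G where G: "hermitian G" "G ** B = B ** G" "B ** G ** B = B" "G ** B ** G = G"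
    using hermitian_pseudoinverse[OF B] by blast
  \<comment> \<open>The difference \<open>?E\<close> satisfies \<open>adj C ** ?E = 0\<close>
    because \<open>B ** G ** B = B\<close>; hence \<open>adj ?E ** ?E = 0\<close>, and
    \<open>?E\<close> vanishes.\<close>
  have CGB: "C ** G ** B = C"
  proof -
    let ?E = "C - C ** G ** B"
    have adjE: "adj ?E = adj C - B ** G ** adj C"
      using G(1) B by (simp add: adj_diff adj_mult hermitian_def matrix_mul_assoc)
    have CE: "adj C ** ?E = B - B ** G ** B"
      by (simp add: matrix_mul_diff_right matrix_mul_assoc B_def)
    have "adj ?E ** ?E = adj C ** ?E - B ** G ** (adj C ** ?E)"
      by (simp only: adjE matrix_mul_diff_left matrix_mul_assoc)
    also have "\<dots> = 0" unfolding CE G(3) by simp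
    finally have "?E = 0" by (rule adj_mult_self_eq_0)
    then show ?thesis by simp
  qed
  define X where "X = n ** G ** adj C ** m"
  have A: "A = m' ** C ** n'"
  proof -
    have "m' ** C ** n' = (m' ** m) ** A ** (n ** n')" by (simp only: C_def matrix_mul_assoc)
    then show ?thesis by (simp add: m' n')
  qed
  have AX: "A ** X = m' ** (C ** G ** adj C) ** m"
  proof -
    have "A ** X = m' ** C ** (n' ** n) ** G ** adj C ** m" by (simp only: A X_def matrix_mul_assoc)
    then show ?thesis by (simp add: n' matrix_mul_assoc)
  qed
  have XA: "X ** A = n ** (G ** B) ** n'"
  proof -
    have "X ** A = n ** G ** adj C ** (m ** m') ** C ** n'" by (simp only: A X_def matrix_mul_assoc)
    then show ?thesis by (simp add: m' matrix_mul_assoc B_def)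
  qed
  have "is_wmp M N A X"
    unfolding is_wmp_def
  proof (intro conjI)
    have "A ** X ** A = A ** (X ** A)" by (simp only: matrix_mul_assoc)
    also have "\<dots> = m' ** C ** (n' ** n) ** G ** B ** n'" unfolding XA by (simp only: A matrix_mul_assoc)
    also have "\<dots> = m' ** (C ** G ** B) ** n'" by (simp add: n' matrix_mul_assoc)
    finally show "A ** X ** A = A" unfolding CGB by (simp only: A)
    have "X ** A ** X = n ** (G ** B) ** (n' ** n) ** G ** adj C ** m"
      unfolding XA by (simp only: X_def matrix_mul_assoc)
    also have "\<dots> = n ** (G ** B ** G) ** adj C ** m" by (simp add: n' matrix_mul_assoc)
    finally show "X ** A ** X = X" unfolding G(4) by (simp only: X_def)
    have "M ** A ** X = M ** (A ** X)" by (simp only: matrix_mul_assoc)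
    also have "\<dots> = m ** (m ** m') ** (C ** G ** adj C) ** m" unfolding AX by (simp only: m(2)[symmetric] matrix_mul_assoc)
    also have "\<dots> = m ** (C ** G ** adj C) ** m" by (simp add: m')
    finally have MAX: "M ** A ** X = m ** (C ** G ** adj C) ** m" .
    show "adj (M ** A ** X) = M ** A ** X"
      using G(1) unfolding MAX by (simp add: adj_mult herm hermitian_def matrix_mul_assoc)
    have "N ** X ** A = n' ** n' ** (X ** A)" by (simp only: N_eq matrix_mul_assoc)
    also have "\<dots> = n' ** (n' ** n) ** (G ** B) ** n'" unfolding XA by (simp only: matrix_mul_assoc)
    also have "\<dots> = n' ** (G ** B) ** n'" by (simp add: n')
    finally have NXA: "N ** X ** A = n' ** (G ** B) ** n'" .
    have "adj (G ** B) = G ** B" using G(1,2) B by (simp add: adj_mult hermitian_def)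
    moreover have "adj (n' ** H ** n') = n' ** adj H ** n'" for H
      by (simp add: adj_mult herm' matrix_mul_assoc)
    ultimately show "adj (N ** X ** A) = N ** X ** A" unfolding NXA by (simp only:)
  qed
  \<comment> \<open>This places the columns of \<open>n' ** X\<close> in the range of
    \<open>B\<close>, as \<open>repl_minor_sum_range\<close> requires.\<close>
  moreover have "(B ** G) ** (n' ** X) = n' ** X"
  proof -
    have n'X: "n' ** X = G ** adj C ** m"
    proof -
      have "n' ** X = (n' ** n) ** G ** adj C ** m" by (simp only: X_def matrix_mul_assoc)
      then show ?thesis by (simp add: n')
    qed
    have "(B ** G) ** (n' ** X) = (G ** B ** G) ** adj C ** m"
      unfolding n'X G(2) by (simp only: matrix_mul_assoc)
    then show ?thesis unfolding G(4) n'X .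
  qed
  moreover have "B = n ** adj A ** M ** A ** n"
    by (simp add: B_def C_def adj_mult herm m(2)[symmetric] matrix_mul_assoc)
  ultimately show thesis
    using G(2,4) n' unfolding B_def by (intro that[of G X n'])
qed

lemma is_wmp_exists:
  fixes A :: "quat^'n^'m"
  assumes "pos_def M" "pos_def N"
  obtains X where "is_wmp M N A X"
  by (rule wmp_construction[OF assms, of A]) (rule that, assumption)

text \<open>Take the adjoint of \<open>M ** A = (M ** A ** X) ** A\<close> and use that
  \<open>M\<close> and \<open>M ** A ** X\<close> are Hermitian.\<close>

lemma is_wmp_normal_equation:
  assumes "pos_def M" "is_wmp M N A X"
  shows "adj A ** M ** A ** X = adj A ** M"
proof -
  have M: "adj M = M" using assms(1) by (simp add: pos_def_iff hermitian_def)
  have "adj (M ** (A ** X ** A)) = adj ((M ** A ** X) ** A)" by (simp only: matrix_mul_assoc)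
  then have "adj (M ** A) = adj A ** (M ** A ** X)" using assms(2) by (simp add: is_wmp_def adj_mult[of _ A])
  then show ?thesis by (simp add: adj_mult M matrix_mul_assoc)
qed

lemma wmp_column_formula:
  fixes A :: "quat^'n::{finite,linorder}^'m::{finite,linorder}"
  assumes M: "pos_def M" and N: "pos_def N" and r: "qrank A = r" "r \<ge> 1"
  defines "n \<equiv> mat_sqrt (matrix_inv N)"
  shows "wmp_inverse M N A $ i $ j =
     (\<Sum>k\<in>UNIV. n $ i $ k * (\<Sum>\<beta>\<in>idx_sets_with r k.
        cdet \<beta> k (repl_col k (column j (n ** adj A ** M)) (n ** adj A ** M ** A ** n))))
     /\<^sub>R (\<Sum>\<beta>\<in>idx_sets r. hdet \<beta> (n ** adj A ** M ** A ** n))"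
proof -
  define C where "C = mat_sqrt M ** A ** n"
  define B where "B = n ** adj A ** M ** A ** n"
  obtain G X n' where c: "G ** (adj C ** C) = (adj C ** C) ** G" "G ** (adj C ** C) ** G = G"
    "is_wmp M N A X" "n ** n' = mat 1" "n' ** n = mat 1" "((adj C ** C) ** G) ** (n' ** X) = n' ** X"
    "adj C ** C = n ** adj A ** M ** A ** n"
    by (rule wmp_construction[OF M N, of A, folded n_def, folded C_def])
  then have BC: "adj C ** C = B" by (simp only: B_def)
  note G = c(1,2)[unfolded BC] and X = c(3) and n' = c(4,5) and BG = c(6)[unfolded BC]
  obtain m' where m': "m' ** mat_sqrt M = mat 1" using pos_def_inverse[OF mat_sqrt(1)[OF M]] by blast
  have rank: "qrank C = r"
    using qrank_mult_right[OF n'(1), of "mat_sqrt M ** A"] qrank_mult_left[OF m', of A] r(1)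
    by (simp add: C_def)
  let ?x = "column j (n' ** X)"
  let ?d = "\<Sum>\<beta>\<in>idx_sets r. hdet \<beta> B"
  have B: "hermitian B" unfolding BC[symmetric] by (rule hermitian_adj_mult_self)
  \<comment> \<open>The normal equation makes the right-hand side of the linear system for
    \<open>?x\<close> explicit.\<close>
  have "B ** (n' ** X) = n ** adj A ** M ** A ** (n ** n') ** X" by (simp only: B_def matrix_mul_assoc)
  also have "\<dots> = n ** (adj A ** M ** A ** X)" by (simp add: n' matrix_mul_assoc)
  also have "\<dots> = n ** adj A ** M" by (simp only: is_wmp_normal_equation[OF M X] matrix_mul_assoc)
  finally have Bx: "B *v ?x = column j (n ** adj A ** M)" by (simp only: column_mult[symmetric])
  have BGx: "(B ** G) *v ?x = ?x" by (simp only: column_mult[symmetric] BG)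
  have d: "minor_sum r B = of_real ?d" by (rule minor_sum_conv_hdet[OF B r(2)])
  have "?d > 0" using gram_minor_sum_pos[of C] unfolding rank BC d by simp
  have "repl_minor_sum r k (column j (n ** adj A ** M)) B = of_real ?d * ?x $ k" for k
    using repl_minor_sum_range[of G C ?x k] G BGx unfolding BC rank Bx d by simp
  then have "?x $ k = repl_minor_sum r k (column j (n ** adj A ** M)) B /\<^sub>R ?d" for k
    using \<open>?d > 0\<close> by (intro solve_of_real_mult) auto
  moreover have "X $ i $ j = (n ** (n' ** X)) $ i $ j" by (simp add: n' matrix_mul_assoc)
  then have "X $ i $ j = (\<Sum>k\<in>UNIV. n $ i $ k * ?x $ k)"
    by (simp add: matrix_matrix_mult_def[of n "n' ** X"] column_def)
  ultimately have "X $ i $ j = (\<Sum>k\<in>UNIV. n $ i $ k * repl_minor_sum r k (column j (n ** adj A ** M)) B) /\<^sub>R ?d"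
    by (simp add: scaleR_sum_right)
  then show ?thesis
    unfolding wmp_inverse_eqI[OF M N X] repl_minor_sum_def B_def .
qed

text \<open>No index set has more than \<open>CARD('n)\<close> elements, so for
  \<open>r = CARD('n)\<close> the recursion reduces to Cramer's rule, applied to the normal equation
  for \<open>X\<close>. The determinant is positive as a Gram minor of
  \<open>M\<^sup>1\<^sup>/\<^sup>2 A\<close>, which has full column rank.\<close>

lemma wmp_column_formula_full_rank:
  fixes A :: "quat^'n::{finite,linorder}^'m::{finite,linorder}"
  assumes M: "pos_def M" and N: "pos_def N" and r: "qrank A = CARD('n)"
  shows "wmp_inverse M N A $ i $ j =
     cdet UNIV i (repl_col i (column j (adj A ** M)) (adj A ** M ** A)) /\<^sub>R hdet UNIV (adj A ** M ** A)"
proof -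
  define B where "B = adj A ** M ** A"
  obtain X where X: "is_wmp M N A X" using M N by (rule is_wmp_exists)
  obtain m where pm: "pos_def m" and m2: "m ** m = M" using mat_sqrt[OF M] by blast
  then have m: "adj m = m" by (simp add: pos_def_iff hermitian_def)
  obtain m' where m': "m' ** m = mat 1" using pos_def_inverse[OF pm] by blast
  have BC: "adj (m ** A) ** (m ** A) = B"
    by (simp add: B_def adj_mult m m2[symmetric] matrix_mul_assoc)
  have rank: "qrank (m ** A) = CARD('n)" using qrank_mult_left[OF m', of A] r by simp
  have B: "hermitian B" unfolding BC[symmetric] by (rule hermitian_adj_mult_self)
  have UNIV_iff: "card \<beta> = CARD('n) \<longleftrightarrow> \<beta> = UNIV" for \<beta> :: "'n set"
    using card_subset_eq[of UNIV \<beta>] by auto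
  have idx: "idx_sets (CARD('n)) = {UNIV :: 'n set}" "idx_sets_with (CARD('n)) i = {UNIV :: 'n set}"
    by (auto simp: idx_sets_def idx_sets_with_def UNIV_iff)
  let ?x = "column j X"
  have Bx: "B *v ?x = column j (adj A ** M)"
    unfolding column_mult[symmetric] B_def is_wmp_normal_equation[OF M X] ..
  have d: "minor_sum (CARD('n)) B = of_real (hdet UNIV B)"
  proof -
    have "CARD('n) \<ge> 1" by (simp add: Suc_leI)
    then show ?thesis using minor_sum_conv_hdet[OF B, of "CARD('n)"] by (simp add: idx)
  qed
  have "hdet UNIV B > 0" using gram_minor_sum_pos[of "m ** A"] unfolding rank BC d by simp
  have "repl_minor_sum (CARD('n)) i (B *v ?x) B = of_real (hdet UNIV B) * ?x $ i"
    using repl_minor_sum_recursion[OF B, of "CARD('n)" i ?x] d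
      repl_minor_sum_eq_0_of_card[of "Suc (CARD('n))" i ?x B] by simp
  then have "cdet UNIV i (repl_col i (column j (adj A ** M)) B) = of_real (hdet UNIV B) * ?x $ i"
    unfolding Bx by (simp add: repl_minor_sum_def idx)
  then have "?x $ i = cdet UNIV i (repl_col i (column j (adj A ** M)) B) /\<^sub>R hdet UNIV B"
    using \<open>hdet UNIV B > 0\<close> by (intro solve_of_real_mult) auto
  then show ?thesis unfolding wmp_inverse_eqI[OF M N X] B_def by (simp add: column_def)
qed

lemma wmp_inverse_adj:
  assumes "pos_def M" "pos_def N"
  shows "wmp_inverse M N A $ i $ j =
    qcnj (wmp_inverse (matrix_inv N) (matrix_inv M) (adj A) $ j $ i)"
proof -
  obtain X where X: "is_wmp M N A X" using assms by (rule is_wmp_exists)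
  have "wmp_inverse (matrix_inv N) (matrix_inv M) (adj A) = adj X"
    using assms X by (intro wmp_inverse_eqI is_wmp_adj pos_def_matrix_inv)
  then show ?thesis using wmp_inverse_eqI[OF assms X] by simp
qed

text \<open>In the column formula for \<open>adj A\<close> the factor on the left is the square root
  of the doubly inverted \<open>M\<close>, that is \<open>mat_sqrt M\<close>. Conjugating the entry
  moves this factor to the right and turns the column determinants into row determinants; the
  denominator is real and stays.\<close>

lemma wmp_row_formula:
  fixes A :: "quat^'n::{finite,linorder}^'m::{finite,linorder}"
  assumes M: "pos_def M" and N: "pos_def N" and r: "qrank A = r" "r \<ge> 1"
  shows "wmp_inverse M N A $ i $ j =
     (\<Sum>l\<in>UNIV. (\<Sum>\<alpha>\<in>idx_sets_with r l.
           rdet \<alpha> l (repl_row l (row i (matrix_inv N ** adj A ** mat_sqrt M))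
             (mat_sqrt M ** A ** matrix_inv N ** adj A ** mat_sqrt M))) * mat_sqrt M $ l $ j)
     /\<^sub>R (\<Sum>\<alpha>\<in>idx_sets r. hdet \<alpha> (mat_sqrt M ** A ** matrix_inv N ** adj A ** mat_sqrt M))"
proof -
  let ?m = "mat_sqrt M" and ?N = "matrix_inv N"
  define B where "B = ?m ** A ** ?N ** adj A ** ?m"
  have m: "hermitian ?m" using mat_sqrt(1)[OF M] by (simp add: pos_def_iff)
  have N': "hermitian ?N" using pos_def_matrix_inv(1)[OF N] by (simp add: pos_def_iff)
  have B: "adj B = B" using m N' by (simp add: B_def adj_mult hermitian_def matrix_mul_assoc)
  have "wmp_inverse ?N (matrix_inv M) (adj A) $ j $ i =
     (\<Sum>l\<in>UNIV. ?m $ j $ l * (\<Sum>\<beta>\<in>idx_sets_with r l.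
        cdet \<beta> l (repl_col l (column i (?m ** A ** ?N)) B))) /\<^sub>R (\<Sum>\<beta>\<in>idx_sets r. hdet \<beta> B)"
    using wmp_column_formula[OF pos_def_matrix_inv(1)[OF N] pos_def_matrix_inv(1)[OF M], of "adj A" r j i] r
    by (simp add: qrank_adj pos_def_matrix_inv(2)[OF M] B_def)
  then have "wmp_inverse M N A $ i $ j = (\<Sum>l\<in>UNIV. (\<Sum>\<beta>\<in>idx_sets_with r l.
        qcnj (cdet \<beta> l (repl_col l (column i (?m ** A ** ?N)) B))) * ?m $ l $ j) /\<^sub>R (\<Sum>\<beta>\<in>idx_sets r. hdet \<beta> B)"
    unfolding wmp_inverse_adj[OF M N, of A] by (simp add: hermitian_nth[OF m])
  moreover have "qcnj (cdet \<beta> l (repl_col l (column i (?m ** A ** ?N)) B)) =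
      rdet \<beta> l (repl_row l (row i (?N ** adj A ** ?m)) B)" for \<beta> l
  proof -
    have "row i (?N ** adj A ** ?m) = row i (adj (?m ** A ** ?N))"
      using m N' by (simp add: adj_mult hermitian_def matrix_mul_assoc)
    then have "(\<chi> j. qcnj (row i (?N ** adj A ** ?m) $ j)) = column i (?m ** A ** ?N)"
      by (simp add: row_def column_def)
    then show ?thesis by (simp add: rdet_repl_row B)
  qed
  ultimately show ?thesis unfolding B_def by simp
qed

lemma wmp_row_formula_full_rank:
  fixes A :: "quat^'n::{finite,linorder}^'m::{finite,linorder}"
  assumes M: "pos_def M" and N: "pos_def N" and r: "qrank A = CARD('m)"
  shows "wmp_inverse M N A $ i $ j =
     rdet UNIV j (repl_row j (row i (matrix_inv N ** adj A)) (A ** matrix_inv N ** adj A))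
     /\<^sub>R hdet UNIV (A ** matrix_inv N ** adj A)"
proof -
  let ?N = "matrix_inv N"
  define B where "B = A ** ?N ** adj A"
  have N': "hermitian ?N" using pos_def_matrix_inv(1)[OF N] by (simp add: pos_def_iff)
  have B: "adj B = B" using N' by (simp add: B_def adj_mult hermitian_def matrix_mul_assoc)
  have "wmp_inverse ?N (matrix_inv M) (adj A) $ j $ i = cdet UNIV j (repl_col j (column i (A ** ?N)) B) /\<^sub>R hdet UNIV B"
    using wmp_column_formula_full_rank[OF pos_def_matrix_inv(1)[OF N] pos_def_matrix_inv(1)[OF M], of "adj A" j i] r
    by (simp add: qrank_adj B_def)
  then have "wmp_inverse M N A $ i $ j = qcnj (cdet UNIV j (repl_col j (column i (A ** ?N)) B)) /\<^sub>R hdet UNIV B"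
    unfolding wmp_inverse_adj[OF M N, of A] by simp
  moreover have "qcnj (cdet UNIV j (repl_col j (column i (A ** ?N)) B)) =
      rdet UNIV j (repl_row j (row i (?N ** adj A)) B)"
  proof -
    have "row i (?N ** adj A) = row i (adj (A ** ?N))"
      using N' by (simp add: adj_mult hermitian_def)
    then have "(\<chi> j. qcnj (row i (?N ** adj A) $ j)) = column i (A ** ?N)"
      by (simp add: row_def column_def)
    then show ?thesis by (simp add: rdet_repl_row B)
  qed
  ultimately show ?thesis unfolding B_def by simp
qed

theorem theorem4p2:
  fixes A :: "quat^'n::{finite,linorder}^'m::{finite,linorder}"
    and M :: "quat^'m::{finite,linorder}^'m::{finite,linorder}" and N :: "quat^'n::{finite,linorder}^'n::{finite,linorder}" and r :: nat
  assumes "qrank A = r" and "r \<ge> 1" and "pos_def M" and "pos_def N"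
  shows
    "(\<not> hermitian (wadj M N A ** A) \<longrightarrow>
        (r < CARD('n) \<longrightarrow> (\<forall>i j.
           wmp_inverse M N A $ i $ j =
             (\<Sum>k\<in>UNIV. mat_sqrt (matrix_inv N) $ i $ k *
                (\<Sum>\<beta>\<in>idx_sets_with r k.
                   cdet \<beta> k (repl_col k (column j (mat_sqrt (matrix_inv N) ** adj A ** M))
                     (mat_sqrt (matrix_inv N) ** adj A ** M ** A ** mat_sqrt (matrix_inv N)))))
             /\<^sub>R (\<Sum>\<beta>\<in>idx_sets r. hdet \<beta> (mat_sqrt (matrix_inv N) ** adj A ** M ** A ** mat_sqrt (matrix_inv N))))) \<and>
        (r = CARD('n) \<longrightarrow> (\<forall>i j.
           wmp_inverse M N A $ i $ j =
             cdet UNIV i (repl_col i (column j (adj A ** M)) (adj A ** M ** A))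
             /\<^sub>R hdet UNIV (adj A ** M ** A)))) \<and>
     (\<not> hermitian (A ** wadj M N A) \<longrightarrow>
        (r < CARD('m) \<longrightarrow> (\<forall>i j.
           wmp_inverse M N A $ i $ j =
             (\<Sum>l\<in>UNIV.
                (\<Sum>\<alpha>\<in>idx_sets_with r l.
                   rdet \<alpha> l (repl_row l (row i (matrix_inv N ** adj A ** mat_sqrt M))
                     (mat_sqrt M ** A ** matrix_inv N ** adj A ** mat_sqrt M)))
                * mat_sqrt M $ l $ j)
             /\<^sub>R (\<Sum>\<alpha>\<in>idx_sets r. hdet \<alpha> (mat_sqrt M ** A ** matrix_inv N ** adj A ** mat_sqrt M)))) \<and>
        (r = CARD('m) \<longrightarrow> (\<forall>i j.
           wmp_inverse M N A $ i $ j =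
             rdet UNIV j (repl_row j (row i (matrix_inv N ** adj A)) (A ** matrix_inv N ** adj A))
             /\<^sub>R hdet UNIV (A ** matrix_inv N ** adj A))))"
  using wmp_column_formula[OF assms(3,4,1,2)] wmp_column_formula_full_rank[OF assms(3,4)]
    wmp_row_formula[OF assms(3,4,1,2)] wmp_row_formula_full_rank[OF assms(3,4)] assms(1)
  by blast

end
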